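(* There is an absolute constant $\gamma_0>0$ such that the following holds. Let $\varepsilon_1,\varepsilon_2,k,\gamma$ satisfy $0.01 \le \varepsilon_1<\varepsilon_2\le 0.49$, $\varepsilon_2-\varepsilon_1 \ge 2^{-k^{0.1}}$, and $1/k \le \gamma \le \gamma_0$. Then any $(k,(1+\gamma)k,\varepsilon_1,\varepsilon_2)$-tester has query complexity $\left(\frac{1}{\gamma}\right)^{\Omega(-\log(\varepsilon_2-\varepsilon_1))}$.
   Context: A function $f:\{0,1\}^n\to\{0,1\}$ is a $k$-junta if it depends on at most $k$ of its input variables. The distance between $f,g$ is $\Pr_{x\sim\{0,1\}^n}[f(x)\ne g(x)]$ for uniform $x$; $f$ is $\varepsilon$-close to a class if its distance to some member is at most $\varepsilon$ and $\varepsilon$-far if its distance to every member is at least $\varepsilon$. For $k\le k'$ and $\varepsilon_1<\varepsilon_2$, a $(k,k',\varepsilon_1,\varepsilon_2)$-tester is a randomized (possibly adaptive) algorithm with query access to $f$ that accepts with probability at least $2/3$ if $f$ is $\varepsilon_1$-close to a $k$-junta and rejects with probability at least $2/3$ if $f$ is $\varepsilon_2$-far from all $k'$-juntas. The $\Omega$ hides an absolute positive constant; logarithms are base 2. *)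

theory Defs
  imports "HOL-Probability.Probability"
begin

definition cube :: "nat \<Rightarrow> bool list set" where
  "cube n = {x. length x = n}"

text \<open>
  A function from \<open>cube n\<close> to \<open>bool\<close> is represented by a function on all Boolean lists;
  the notions below only inspect its values on \<open>cube n\<close>.
\<close>

definition depends_on :: "nat \<Rightarrow> (bool list \<Rightarrow> bool) \<Rightarrow> nat \<Rightarrow> bool" where
  "depends_on n f i \<longleftrightarrow> i < n \<and> (\<exists>x\<in>cube n. f (x[i := \<not> x ! i]) \<noteq> f x)"

text \<open>The bound \<open>k\<close> is real because it is also used for values such as \<open>(1 + \<gamma>) * k\<close>.\<close>

definition junta :: "nat \<Rightarrow> real \<Rightarrow> (bool list \<Rightarrow> bool) \<Rightarrow> bool" where
  "junta n k f \<longleftrightarrow> real (card {i. depends_on n f i}) \<le> k"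

definition fun_dist :: "nat \<Rightarrow> (bool list \<Rightarrow> bool) \<Rightarrow> (bool list \<Rightarrow> bool) \<Rightarrow> real" where
  "fun_dist n f g = measure_pmf.prob (pmf_of_set (cube n)) {x. f x \<noteq> g x}"

definition close_to_junta :: "nat \<Rightarrow> real \<Rightarrow> real \<Rightarrow> (bool list \<Rightarrow> bool) \<Rightarrow> bool" where
  "close_to_junta n k \<epsilon> f \<longleftrightarrow> (\<exists>g. junta n k g \<and> fun_dist n f g \<le> \<epsilon>)"

definition far_from_juntas :: "nat \<Rightarrow> real \<Rightarrow> real \<Rightarrow> (bool list \<Rightarrow> bool) \<Rightarrow> bool" where
  "far_from_juntas n k \<epsilon> f \<longleftrightarrow> (\<forall>g. junta n k g \<longrightarrow> fun_dist n f g \<ge> \<epsilon>)"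

text \<open>
  A deterministic adaptive query algorithm: \<open>Query x t0 t1\<close> queries the point \<open>x\<close> and continues
  with \<open>t1\<close> if the answer is \<open>True\<close> and with \<open>t0\<close> otherwise; \<open>Leaf True\<close> accepts.
\<close>

datatype query_tree = Leaf bool | Query "bool list" query_tree query_tree

primrec accepts :: "query_tree \<Rightarrow> (bool list \<Rightarrow> bool) \<Rightarrow> bool" where
  "accepts (Leaf b) f = b"
| "accepts (Query x t0 t1) f = (if f x then accepts t1 f else accepts t0 f)"

primrec num_queries :: "query_tree \<Rightarrow> (bool list \<Rightarrow> bool) \<Rightarrow> nat" where
  "num_queries (Leaf b) f = 0"
| "num_queries (Query x t0 t1) f =
     Suc (if f x then num_queries t1 f else num_queries t0 f)"

primrec queried_points :: "query_tree \<Rightarrow> bool list set" where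
  "queried_points (Leaf b) = {}"
| "queried_points (Query x t0 t1) = insert x (queried_points t0 \<union> queried_points t1)"

text \<open>
  A randomized algorithm receives the number \<open>n\<close> of variables and draws a deterministic query
  algorithm according to its internal randomness. Discrete distributions lose no generality, as
  there are only countably many query trees.
\<close>

type_synonym query_algorithm = "nat \<Rightarrow> query_tree pmf"

definition is_query_algorithm :: "query_algorithm \<Rightarrow> bool" where
  "is_query_algorithm A \<longleftrightarrow> (\<forall>n. \<forall>t\<in>set_pmf (A n). queried_points t \<subseteq> cube n)"

definition is_junta_tester :: "real \<Rightarrow> real \<Rightarrow> real \<Rightarrow> real \<Rightarrow> query_algorithm \<Rightarrow> bool" where
  "is_junta_tester k k' \<epsilon>\<^sub>1 \<epsilon>\<^sub>2 A \<longleftrightarrow>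
     is_query_algorithm A \<and>
     (\<forall>n f. close_to_junta n k \<epsilon>\<^sub>1 f \<longrightarrow>
        measure_pmf.prob (A n) {t. accepts t f} \<ge> 2 / 3) \<and>
     (\<forall>n f. far_from_juntas n k' \<epsilon>\<^sub>2 f \<longrightarrow>
        measure_pmf.prob (A n) {t. \<not> accepts t f} \<ge> 2 / 3)"

text \<open>
  The worst-case number of queries over the number of variables, the input function and the
  internal randomness (\<open>\<infinity>\<close> if there is no uniform bound).
\<close>

definition query_complexity :: "query_algorithm \<Rightarrow> enat" where
  "query_complexity A = (SUP n. SUP f. SUP t\<in>set_pmf (A n). enat (num_queries t f))"

end

theory Submission
  imports Defs
begin

text \<open>
  Public address bits \<open>u\<close> select one variable from each of \<open>w\<close> blocks, and a uniformly random
  function \<open>G\<close> is applied to \<open>u\<close> and the selected bits \<open>Z\<close>.  Such a function is far from all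
  \<open>(1 + \<gamma>) * k\<close>-juntas: a junta must ignore many variables, hence a random selection contains many
  ignored ones, and a Chernoff bound with a union bound over all juntas applies.

  The close functions have a secret set \<open>T\<close> containing a fraction \<open>1 / E\<close> of each block,
  where \<open>E\<close> is about \<open>(1 / \<gamma>) powr (1 / 4)\<close>.  On the selected bits that lie in \<open>T\<close>, the
  words of a code of minimum distance \<open>s\<close> are identified before \<open>G\<close> is applied, which correlates the
  function with a junta ignoring \<open>T\<close>; the code occupies a \<open>2 powr (- O(s))\<close> fraction of the words.
  The answers remain independent uniform bits until two queries with the same address differ in at
  least \<open>s\<close> selected bits, all of them in \<open>T\<close>.  For a given pair of queries this has probability at
  most \<open>E powr (- s)\<close> over the choice of \<open>T\<close>, so about \<open>E powr (s / 2)\<close> queries are needed, with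
  \<open>s\<close> proportional to \<open>- log 2 (\<epsilon>\<^sub>2 - \<epsilon>\<^sub>1)\<close>.
\<close>

section \<open>Random subsets and codes\<close>

text \<open>Forgetting the secret variables altogether would give an exact junta, but a query pair
  differing in one hidden bit would expose it with probability about \<open>1 / E\<close>. Merging
  only codewords lowers this to \<open>E powr (- s)\<close>, while the advantage of the junta over
  random guessing drops to the density of the code. This trade-off puts the logarithm of the gap
  into the exponent. A second tension concerns the mean number \<open>D\<close> of hidden bits among
  the \<open>w = D * E\<close> selected ones. Far juntas may ignore as few as half as many variables
  as there are secret ones, so farness holds only up to an error
  \<open>\<eta> = exp (- D / 8)\<close>, which the code density must beat although it decays with
  \<open>D\<close> as well. The Gilbert--Varshamov bound with a free parameter \<open>x\<close>
  gives density \<open>x ^ (s - 1) * (1 - x) ^ D\<close>; for a small constant \<open>x\<close> its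
  decay in \<open>D\<close> is slower than that of \<eta>, and \<open>D\<close> proportional to
  \<open>s\<close> suffices. The exponent \<open>1 / 4\<close> in \<open>E\<close> ensures
  \<open>E ^ 4 \<le> 1 / \<gamma> \<le> k\<close>, so that a slack of \<open>k / (2 * E)\<close>
  variables absorbs \<open>\<gamma> * k\<close>, the address bits and the rounding of the block
  size.\<close>

lemma sum_exp_card_Int_le:
  fixes h :: real
  assumes K: "finite K" and B: "B \<subseteq> K" and h: "h \<ge> 0"
  shows "(\<Sum>G\<in>Pow K. exp (h * real (card (G \<inter> B)))) \<le>
           2 ^ card K * exp (h * real (card B) / 2 + h\<^sup>2 * real (card B) / 8)"
proof -
  have fB: "finite B" using K B finite_subset by blast
  have "exp (- (h / 2) + ln (1 + (exp h - 1) / 2)) \<le> exp (h\<^sup>2 / 8)"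
    using Hoeffdings_lemma_aux[of h "1/2"] h by simp
  moreover have "exp (- (h / 2) + ln (1 + (exp h - 1) / 2)) = exp (- (h / 2)) * ((1 + exp h) / 2)"
    by (subst exp_add, subst exp_ln) (auto simp: field_simps add_pos_pos)
  ultimately have "exp (- (h / 2)) * ((1 + exp h) / 2) \<le> exp (h\<^sup>2 / 8)"
    by (simp only:)
  then have "exp (h / 2) * (exp (- (h / 2)) * ((1 + exp h) / 2)) \<le> exp (h / 2) * exp (h\<^sup>2 / 8)"
    by (rule mult_left_mono) simp
  then have one: "exp h + 1 \<le> 2 * exp (h / 2 + h\<^sup>2 / 8)"
    by (simp add: mult_exp_exp flip: mult.assoc)
  \<comment> \<open>A sum over subsets of a product over elements expands a product of binomials, so
    the exponential moment factors into fair coins, each bounded by \<open>one\<close>.\<close>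
  have "(\<Sum>G\<in>Pow K. exp (h * real (card (G \<inter> B)))) =
        (\<Sum>G\<in>Pow K. (\<Prod>i\<in>G. if i \<in> B then exp h else 1) * (\<Prod>i\<in>K - G. 1))"
  proof (intro sum.cong refl)
    fix G assume "G \<in> Pow K"
    then have "finite G" using K finite_subset by blast
    then show "exp (h * real (card (G \<inter> B))) =
        (\<Prod>i\<in>G. if i \<in> B then exp h else 1) * (\<Prod>i\<in>K - G. 1)"
      by (simp add: prod.If_cases Int_def mult.commute flip: exp_of_nat_mult)
  qed
  also have "\<dots> = (\<Prod>i\<in>K. (if i \<in> B then exp h else 1) + 1)"
    by (rule prod_add[symmetric, OF K])
  also have "\<dots> = (\<Prod>i\<in>K. if i \<in> B then exp h + 1 else 2)"
    by (intro prod.cong) auto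
  also have "\<dots> = (exp h + 1) ^ card B * 2 ^ card (K - B)"
    using K B by (simp add: prod.If_cases Int_absorb1 Collect_neg_eq Diff_eq)
  also have "\<dots> \<le> (2 * exp (h / 2 + h\<^sup>2 / 8)) ^ card B * 2 ^ card (K - B)"
    by (intro mult_right_mono power_mono one) (auto intro: add_nonneg_nonneg)
  also have "\<dots> = 2 ^ (card B + card (K - B)) * exp (h / 2 + h\<^sup>2 / 8) ^ card B"
    by (simp add: power_mult_distrib power_add)
  also have "card B + card (K - B) = card K"
    using K B fB by (simp add: card_Diff_subset card_mono)
  also have "exp (h / 2 + h\<^sup>2 / 8) ^ card B = exp (h * real (card B) / 2 + h\<^sup>2 * real (card B) / 8)"
    by (subst exp_of_nat_mult[symmetric]) (simp add: algebra_simps)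
  finally show ?thesis .
qed

text \<open>Chernoff bound from the exponential moment. The exponent has \<open>card K\<close> where
  \<open>card B\<close> would be sharper, so that one bound serves all \<open>B\<close>.\<close>

lemma card_subsets_tail:
  fixes c :: real
  assumes K: "finite K" "K \<noteq> {}" and B: "B \<subseteq> K" and c: "c \<ge> 0"
  shows "real (card {G \<in> Pow K. real (card B) / 2 + c \<le> real (card (G \<inter> B))}) \<le>
           2 ^ card K * exp (- 2 * c\<^sup>2 / real (card K))"
proof -
  \<comment> \<open>This \<open>h\<close> minimises \<open>h\<^sup>2 * N / 8 - h * c\<close>, with
    minimum \<open>- 2 * c\<^sup>2 / N\<close>.\<close>
  define N h where "N = real (card K)" and "h = 4 * c / N"
  let ?T = "{G \<in> Pow K. real (card B) / 2 + c \<le> real (card (G \<inter> B))}"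
  have N: "N > 0" using K by (simp add: N_def card_gt_0_iff)
  have BN: "real (card B) \<le> N" using K B by (simp add: N_def card_mono)
  have h: "h \<ge> 0" using c N by (simp add: h_def)
  have "real (card ?T) * exp (h * (real (card B) / 2 + c)) \<le>
        (\<Sum>G\<in>?T. exp (h * real (card (G \<inter> B))))"
    using h by (subst sum_constant[symmetric], intro sum_mono) (auto intro: mult_left_mono)
  also have "\<dots> \<le> (\<Sum>G\<in>Pow K. exp (h * real (card (G \<inter> B))))"
    using K by (intro sum_mono2) auto
  also have "\<dots> \<le> 2 ^ card K * exp (h * real (card B) / 2 + h\<^sup>2 * real (card B) / 8)"
    by (rule sum_exp_card_Int_le[OF K(1) B h])
  also have "\<dots> \<le> 2 ^ card K * exp (h * real (card B) / 2 + h\<^sup>2 * N / 8)"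
    using BN by (auto intro!: mult_left_mono)
  also have "h * real (card B) / 2 + h\<^sup>2 * N / 8 = h * (real (card B) / 2 + c) + (- 2 * c\<^sup>2 / N)"
    using N by (simp add: h_def field_simps power2_eq_square)
  finally have "real (card ?T) * exp (h * (real (card B) / 2 + c)) \<le>
     (2 ^ card K * exp (- 2 * c\<^sup>2 / N)) * exp (h * (real (card B) / 2 + c))"
    by (subst (asm) exp_add) (simp add: mult_ac)
  then show ?thesis unfolding N_def by simp
qed

text \<open>Complementing the symmetric difference with a fixed \<open>F\<close> is an involution on
  \<open>Pow K\<close>, so the distance of a random set to \<open>F\<close> has the law of a random
  size.\<close>

lemma card_subsets_near:
  fixes c :: real
  assumes K: "finite K" "K \<noteq> {}" and F: "F \<subseteq> K" and c: "c \<ge> 0"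
  shows "real (card {G \<in> Pow K. real (card (sym_diff G F)) \<le> real (card K) / 2 - c}) \<le>
           2 ^ card K * exp (- 2 * c\<^sup>2 / real (card K))"
proof -
  let ?\<phi> = "\<lambda>G. K - sym_diff G F"
  have "inj_on ?\<phi> (Pow K)"
    by (rule inj_on_inverseI[where g = ?\<phi>]) (use F in auto)
  then have "card {G \<in> Pow K. real (card (sym_diff G F)) \<le> real (card K) / 2 - c} \<le>
             card {G \<in> Pow K. real (card K) / 2 + c \<le> real (card (G \<inter> K))}"
  proof (intro card_inj_on_le[where f = ?\<phi>])
    show "?\<phi> ` {G \<in> Pow K. real (card (sym_diff G F)) \<le> real (card K) / 2 - c}
       \<subseteq> {G \<in> Pow K. real (card K) / 2 + c \<le> real (card (G \<inter> K))}"
    proof clarsimp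
      fix G assume G: "G \<subseteq> K" and le: "real (card (sym_diff G F)) \<le> real (card K) / 2 - c"
      have sub: "sym_diff G F \<subseteq> K" using G F by auto
      have "real (card ((K - sym_diff G F) \<inter> K)) = real (card K) - real (card (sym_diff G F))"
        using card_Diff_subset[OF finite_subset[OF sub K(1)] sub] card_mono[OF K(1) sub]
        by (simp add: Int_absorb2 Diff_subset of_nat_diff)
      then show "real (card K) / 2 + c \<le> real (card ((K - sym_diff G F) \<inter> K))"
        using le by linarith
    qed
  qed (use K in \<open>auto intro: inj_on_subset\<close>)
  then have "real (card {G \<in> Pow K. real (card (sym_diff G F)) \<le> real (card K) / 2 - c}) \<le>
     real (card {G \<in> Pow K. real (card K) / 2 + c \<le> real (card (G \<inter> K))})"
    by (rule of_nat_mono)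
  also have "\<dots> \<le> 2 ^ card K * exp (- 2 * c\<^sup>2 / real (card K))"
    by (rule card_subsets_tail[OF K subset_refl c])
  finally show ?thesis .
qed

text \<open>Words are subsets of \<open>D\<close>. The empty word is required because it will
  represent all codewords, and must then be far from the others itself.\<close>

definition is_code :: "nat \<Rightarrow> 'a set \<Rightarrow> 'a set set \<Rightarrow> bool" where
  "is_code s D C \<longleftrightarrow> C \<subseteq> Pow D \<and> {} \<in> C \<and>
     (\<forall>Y\<in>C. \<forall>Y'\<in>C. Y \<noteq> Y' \<longrightarrow> s \<le> card (sym_diff Y Y'))"

text \<open>Give each word the weight \<open>x ^ card Y'\<close>: a word of the ball weighs at least
  \<open>x ^ m\<close>, and all words together weigh \<open>(1 + x) ^ card D\<close>. Leaving
  \<open>x\<close> free instead of passing to the entropy bound allows averaging later over hidden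
  sets of varying size.\<close>

lemma card_Hamming_ball_le:
  fixes x :: real
  assumes D: "finite D" and x: "0 < x" "x \<le> 1" and Y: "Y \<subseteq> D"
  shows "real (card {Y' \<in> Pow D. card (sym_diff Y Y') \<le> m}) * x ^ m \<le> (1 + x) ^ card D"
proof -
  have "card {Y' \<in> Pow D. card (sym_diff Y Y') \<le> m} \<le> card {Y' \<in> Pow D. card Y' \<le> m}"
    by (rule card_inj_on_le[where f = "sym_diff Y"])
      (use Y D in \<open>auto intro!: inj_on_inverseI[where g = "sym_diff Y"]\<close>)
  then have "real (card {Y' \<in> Pow D. card (sym_diff Y Y') \<le> m}) * x ^ m \<le>
      real (card {Y' \<in> Pow D. card Y' \<le> m}) * x ^ m"
    using x by (intro mult_right_mono) auto
  also have "\<dots> \<le> (\<Sum>Y'\<in>{Y' \<in> Pow D. card Y' \<le> m}. x ^ card Y')"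
    using x by (subst sum_constant[symmetric], intro sum_mono) (auto intro: power_decreasing)
  also have "\<dots> \<le> (\<Sum>Y'\<in>Pow D. x ^ card Y')"
    using x D by (intro sum_mono2) auto
  also have "\<dots> = (\<Prod>i\<in>D. x + 1)"
    by (subst prod_add[OF D]) simp
  finally show ?thesis by (simp add: add.commute)
qed

text \<open>Gilbert--Varshamov: the balls of radius \<open>s - 1\<close> around a maximal code cover the cube.\<close>

lemma code_exists:
  assumes D: "finite D" and s: "s \<ge> 1"
  shows "\<exists>C. is_code s D C \<and> (\<forall>x::real. 0 < x \<longrightarrow> x \<le> 1 \<longrightarrow>
           2 ^ card D * x ^ (s - 1) \<le> real (card C) * (1 + x) ^ card D)"
proof -
  have bound: "\<forall>C. is_code s D C \<longrightarrow> card C \<le> card (Pow D)"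
    using D by (auto simp: is_code_def intro: card_mono)
  have triv: "is_code s D {{}}" by (simp add: is_code_def)
  have "\<exists>C. is_code s D C \<and> (\<forall>C'. is_code s D C' \<longrightarrow> card C' \<le> card C)"
    by (rule ex_has_greatest_nat[where P = "is_code s D" and f = card and b = "Suc (card (Pow D))", OF triv])
      (use bound in \<open>auto simp: less_Suc_eq_le\<close>)
  then obtain C where C: "is_code s D C" and mx: "\<And>C'. is_code s D C' \<Longrightarrow> card C' \<le> card C"
    by blast
  have CD: "C \<subseteq> Pow D" using C by (simp add: is_code_def)
  then have fC: "finite C" using D finite_subset by auto
  have cover: "Pow D \<subseteq> (\<Union>Y\<in>C. {Y' \<in> Pow D. card (sym_diff Y Y') \<le> s - 1})"
  proof
    fix Y' assume Y': "Y' \<in> Pow D"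
    show "Y' \<in> (\<Union>Y\<in>C. {Y' \<in> Pow D. card (sym_diff Y Y') \<le> s - 1})"
    proof (rule ccontr)
      assume "\<not> ?thesis"
      then have far: "\<And>Y. Y \<in> C \<Longrightarrow> s \<le> card (sym_diff Y Y')" using Y' by force
      have "Y' \<notin> C" using far[of Y'] s by auto
      moreover have "is_code s D (insert Y' C)"
        using C Y' far unfolding is_code_def by (auto simp: Un_commute)
      ultimately show False using mx[of "insert Y' C"] fC by simp
    qed
  qed
  show ?thesis
  proof (intro exI[of _ C] conjI allI impI)
    fix x :: real assume x: "0 < x" "x \<le> 1"
    have "card (Pow D) \<le> card (\<Union>Y\<in>C. {Y' \<in> Pow D. card (sym_diff Y Y') \<le> s - 1})"
      using fC D by (intro card_mono cover) auto
    also have "\<dots> \<le> (\<Sum>Y\<in>C. card {Y' \<in> Pow D. card (sym_diff Y Y') \<le> s - 1})"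
      by (rule card_UN_le[OF fC])
    finally have "real (card (Pow D)) \<le> (\<Sum>Y\<in>C. real (card {Y' \<in> Pow D. card (sym_diff Y Y') \<le> s - 1}))"
      by (simp flip: of_nat_sum)
    then have "2 ^ card D * x ^ (s - 1) \<le>
        (\<Sum>Y\<in>C. real (card {Y' \<in> Pow D. card (sym_diff Y Y') \<le> s - 1})) * x ^ (s - 1)"
      using x D by (intro mult_right_mono) (auto simp: card_Pow)
    also have "\<dots> = (\<Sum>Y\<in>C. real (card {Y' \<in> Pow D. card (sym_diff Y Y') \<le> s - 1}) * x ^ (s - 1))"
      by (rule sum_distrib_right)
    also have "\<dots> \<le> (\<Sum>Y\<in>C. (1 + x) ^ card D)"
      using CD by (intro sum_mono card_Hamming_ball_le D x) auto
    finally show "2 ^ card D * x ^ (s - 1) \<le> real (card C) * (1 + x) ^ card D" by simp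
  qed (rule C)
qed

section \<open>Adaptive queries to a random function\<close>

primrec query_path :: "query_tree \<Rightarrow> (bool list \<Rightarrow> bool) \<Rightarrow> bool list set" where
  "query_path (Leaf b) f = {}"
| "query_path (Query x t0 t1) f =
     insert x (if f x then query_path t1 f else query_path t0 f)"

lemma query_path_card_le: "finite (query_path t f) \<and> card (query_path t f) \<le> num_queries t f"
  by (induction t) (simp_all add: card_insert_if le_SucI)

lemma card_subsets_between:
  assumes K: "finite K" and P: "P \<subseteq> K" "N \<subseteq> K" "P \<inter> N = {}"
  shows "card {G \<in> Pow K. P \<subseteq> G \<and> N \<inter> G = {}} = 2 ^ (card K - card (P \<union> N))"
proof -
  have "bij_betw (\<lambda>G. G \<union> P) (Pow (K - (P \<union> N))) {G \<in> Pow K. P \<subseteq> G \<and> N \<inter> G = {}}"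
    by (rule bij_betw_byWitness[where f' = "\<lambda>G. G - P"]) (use P in auto)
  then have "card {G \<in> Pow K. P \<subseteq> G \<and> N \<inter> G = {}} = card (Pow (K - (P \<union> N)))"
    by (simp add: bij_betw_same_card)
  also have "\<dots> = 2 ^ (card K - card (P \<union> N))"
    using K P by (subst card_Pow) (auto simp: card_Diff_subset finite_subset)
  finally show ?thesis .
qed

text \<open>\<open>Q\<close> is a transcript of queries and answers, and each distinct key in it
  fixes one membership bit of \<open>G\<close>. The point is that the count sees \<kappa> only
  through which queried points share a key.\<close>

lemma card_subsets_answers:
  assumes K: "finite K" and \<kappa>: "\<And>x. x \<in> fst ` Q \<Longrightarrow> \<kappa> x \<in> K"
  shows "card {G \<in> Pow K. \<forall>(x,a)\<in>Q. (\<kappa> x \<in> G) = a} =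
     (if \<exists>x y. (x,True) \<in> Q \<and> (y,False) \<in> Q \<and> \<kappa> x = \<kappa> y then 0
      else 2 ^ (card K - card (\<kappa> ` fst ` Q)))"
proof -
  define P N where "P = \<kappa> ` {x. (x,True) \<in> Q}" and "N = \<kappa> ` {x. (x,False) \<in> Q}"
  have eq: "{G \<in> Pow K. \<forall>(x,a)\<in>Q. (\<kappa> x \<in> G) = a} = {G \<in> Pow K. P \<subseteq> G \<and> N \<inter> G = {}}"
  proof (rule Collect_cong)
    fix G
    have "(\<forall>(x,a)\<in>Q. (\<kappa> x \<in> G) = a) \<longleftrightarrow>
        (\<forall>x. (x,True) \<in> Q \<longrightarrow> \<kappa> x \<in> G) \<and> (\<forall>x. (x,False) \<in> Q \<longrightarrow> \<kappa> x \<notin> G)"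
      by (simp add: Ball_def split_paired_All all_bool_eq) blast
    then show "(G \<in> Pow K \<and> (\<forall>(x,a)\<in>Q. (\<kappa> x \<in> G) = a)) = (G \<in> Pow K \<and> P \<subseteq> G \<and> N \<inter> G = {})"
      unfolding P_def N_def by blast
  qed
  have PN: "P \<union> N = \<kappa> ` fst ` Q"
  proof -
    have "fst ` Q = {x. (x,True) \<in> Q} \<union> {x. (x,False) \<in> Q}"
    proof (intro set_eqI iffI)
      fix x assume "x \<in> fst ` Q"
      then obtain a where "(x,a) \<in> Q" by force
      then show "x \<in> {x. (x,True) \<in> Q} \<union> {x. (x,False) \<in> Q}" by (cases a) auto
    qed force
    then show ?thesis unfolding P_def N_def by (simp add: image_Un)
  qed
  have sub: "P \<subseteq> K" "N \<subseteq> K" unfolding P_def N_def using \<kappa> by force+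
  have iff: "(\<exists>x y. (x,True) \<in> Q \<and> (y,False) \<in> Q \<and> \<kappa> x = \<kappa> y) \<longleftrightarrow> P \<inter> N \<noteq> {}"
    unfolding P_def N_def by blast
  show ?thesis
  proof (cases "P \<inter> N = {}")
    case True
    then show ?thesis using card_subsets_between[OF K sub True] iff eq PN by simp
  next
    case False
    then have "{G \<in> Pow K. P \<subseteq> G \<and> N \<inter> G = {}} = {}" by auto
    then show ?thesis using False iff eq by (simp only: card.empty not_False_eq_True if_True)
  qed
qed

text \<open>In use \<kappa>' is coarser than \<kappa>, so this says that both maps induce the same
  partition of \<open>X\<close>.\<close>

definition separated :: "('a \<Rightarrow> 'b) \<Rightarrow> ('a \<Rightarrow> 'c) \<Rightarrow> 'a set \<Rightarrow> bool" where
  "separated \<kappa> \<kappa>' X \<longleftrightarrow> (\<forall>x\<in>X. \<forall>y\<in>X. \<kappa>' x = \<kappa>' y \<longrightarrow> \<kappa> x = \<kappa> y)"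

lemma separated_mono: "separated \<kappa> \<kappa>' X \<Longrightarrow> Y \<subseteq> X \<Longrightarrow> separated \<kappa> \<kappa>' Y"
  unfolding separated_def by blast

lemma card_image_separated:
  assumes "separated \<kappa> \<kappa>' X" and coarser: "\<And>x y. \<kappa> x = \<kappa> y \<Longrightarrow> \<kappa>' x = \<kappa>' y"
  shows "card (\<kappa> ` X) = card (\<kappa>' ` X)"
proof (rule bij_betw_same_card)
  define \<phi> where "\<phi> z = \<kappa>' (SOME x. x \<in> X \<and> \<kappa> x = z)" for z
  have \<phi>: "\<phi> (\<kappa> y) = \<kappa>' y" if "y \<in> X" for y
  proof -
    have "(SOME x. x \<in> X \<and> \<kappa> x = \<kappa> y) \<in> X \<and> \<kappa> (SOME x. x \<in> X \<and> \<kappa> x = \<kappa> y) = \<kappa> y"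
      by (rule someI[where x = y]) (simp add: that)
    then show ?thesis unfolding \<phi>_def using coarser by (elim conjE)
  qed
  have "inj_on \<phi> (\<kappa> ` X)"
  proof (rule inj_onI)
    fix z z' assume "z \<in> \<kappa> ` X" "z' \<in> \<kappa> ` X" and eq: "\<phi> z = \<phi> z'"
    then obtain y y' where y: "y \<in> X" "z = \<kappa> y" "y' \<in> X" "z' = \<kappa> y'" by blast
    then have "\<kappa>' y = \<kappa>' y'" using eq \<phi>[of y] \<phi>[of y'] by simp
    then show "z = z'" using assms(1) y unfolding separated_def by blast
  qed
  moreover have "\<phi> ` \<kappa> ` X = \<kappa>' ` X"
    unfolding image_image using \<phi> by (intro image_cong) auto
  ultimately show "bij_betw \<phi> (\<kappa> ` X) (\<kappa>' ` X)"
    by (simp add: bij_betw_def)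
qed

text \<open>
  As long as two key maps identify the same pairs of queried points, the answers have the same
  joint distribution.
\<close>

lemma accepts_key_map_le_aux:
  assumes K: "finite K"
    and iff: "\<And>x. \<kappa>' x \<in> K \<longleftrightarrow> \<kappa> x \<in> K"
    and coarser: "\<And>x y. \<kappa> x = \<kappa> y \<Longrightarrow> \<kappa>' x = \<kappa>' y"
    and Q: "\<forall>x\<in>fst ` Q. \<kappa> x \<in> K"
    and sep: "separated \<kappa> \<kappa>' (fst ` Q)"
  shows "card {G \<in> Pow K. (\<forall>(x,a)\<in>Q. (\<kappa> x \<in> G) = a) \<and> accepts t (\<lambda>x. \<kappa> x \<in> G) = \<beta> \<and>
              separated \<kappa> \<kappa>' (fst ` Q \<union> query_path t (\<lambda>x. \<kappa> x \<in> G))}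
       \<le> card {G \<in> Pow K. (\<forall>(x,a)\<in>Q. (\<kappa>' x \<in> G) = a) \<and> accepts t (\<lambda>x. \<kappa>' x \<in> G) = \<beta>}"
    (is "card (?L Q t) \<le> card (?R Q t)")
  using Q sep
\<comment> \<open>\<open>Q\<close> is the transcript so far; each query extends it, hence the
  generalisation.\<close>
proof (induction t arbitrary: Q)
  case (Leaf b)
  show ?case
  proof (cases "b = \<beta>")
    case True
    have "(\<exists>x y. (x,True) \<in> Q \<and> (y,False) \<in> Q \<and> \<kappa> x = \<kappa> y) \<longleftrightarrow>
        (\<exists>x y. (x,True) \<in> Q \<and> (y,False) \<in> Q \<and> \<kappa>' x = \<kappa>' y)"
      using Leaf.prems(2) coarser unfolding separated_def by (metis fst_conv image_eqI)
    moreover have "card {G \<in> Pow K. \<forall>(x,a)\<in>Q. (\<kappa> x \<in> G) = a} =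
     (if \<exists>x y. (x,True) \<in> Q \<and> (y,False) \<in> Q \<and> \<kappa> x = \<kappa> y then 0
      else 2 ^ (card K - card (\<kappa> ` fst ` Q)))"
      by (rule card_subsets_answers[OF K, where Q = Q and \<kappa> = \<kappa>]) (use Leaf.prems(1) in blast)
    moreover have "card {G \<in> Pow K. \<forall>(x,a)\<in>Q. (\<kappa>' x \<in> G) = a} =
     (if \<exists>x y. (x,True) \<in> Q \<and> (y,False) \<in> Q \<and> \<kappa>' x = \<kappa>' y then 0
      else 2 ^ (card K - card (\<kappa>' ` fst ` Q)))"
      by (rule card_subsets_answers[OF K, where Q = Q and \<kappa> = \<kappa>']) (use Leaf.prems(1) iff in blast)
    ultimately have "card {G \<in> Pow K. \<forall>(x,a)\<in>Q. (\<kappa> x \<in> G) = a} =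
        card {G \<in> Pow K. \<forall>(x,a)\<in>Q. (\<kappa>' x \<in> G) = a}"
      using card_image_separated[OF Leaf.prems(2) coarser] by simp
    moreover have "?R Q (Leaf b) = {G \<in> Pow K. \<forall>(x,a)\<in>Q. (\<kappa>' x \<in> G) = a}"
      using True by simp
    moreover have "?L Q (Leaf b) = {G \<in> Pow K. \<forall>(x,a)\<in>Q. (\<kappa> x \<in> G) = a}"
      using True Leaf.prems(2) by simp
    ultimately show ?thesis by simp
  qed simp
next
  case (Query x t0 t1)
  show ?case
  proof (cases "\<kappa> x \<in> K")
    \<comment> \<open>A key outside \<open>K\<close> is answered with False under both maps, so the
      run continues in \<open>t0\<close> and nothing is learnt about \<open>G\<close>.\<close>
    case False
    have "?L Q (Query x t0 t1) \<subseteq> ?L Q t0"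
    proof
      fix G assume G: "G \<in> ?L Q (Query x t0 t1)"
      then have "\<kappa> x \<notin> G" using False by auto
      then show "G \<in> ?L Q t0" using G by (auto elim: separated_mono)
    qed
    then have "card (?L Q (Query x t0 t1)) \<le> card (?L Q t0)"
      using K by (intro card_mono) auto
    also have "\<dots> \<le> card (?R Q t0)" by (rule Query.IH(1)[OF Query.prems])
    also have "?R Q t0 = ?R Q (Query x t0 t1)" using False iff[of x] by auto
    finally show ?thesis .
  next
    case True
    have step: "card (?L (insert (x,a) Q) t) \<le> card (?R (insert (x,a) Q) t)" if "t \<in> {t0,t1}" for a t
    proof (cases "separated \<kappa> \<kappa>' (fst ` insert (x,a) Q)")
      case good: True
      have "\<forall>y\<in>fst ` insert (x,a) Q. \<kappa> y \<in> K" using True Query.prems by auto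
      then show ?thesis using Query.IH good that by blast
    next
      case False
      then have "?L (insert (x,a) Q) t = {}" using separated_mono by blast
      then show ?thesis by (simp only: card.empty zero_le)
    qed
    have "?L Q (Query x t0 t1) \<subseteq> ?L (insert (x,True) Q) t1 \<union> ?L (insert (x,False) Q) t0"
    proof
      fix G assume G: "G \<in> ?L Q (Query x t0 t1)"
      then show "G \<in> ?L (insert (x,True) Q) t1 \<union> ?L (insert (x,False) Q) t0"
        by (cases "\<kappa> x \<in> G") simp_all
    qed
    then have "card (?L Q (Query x t0 t1)) \<le> card (?L (insert (x,True) Q) t1 \<union> ?L (insert (x,False) Q) t0)"
      using K by (intro card_mono) auto
    also have "\<dots> \<le> card (?L (insert (x,True) Q) t1) + card (?L (insert (x,False) Q) t0)"
      by (rule card_Un_le)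
    also have "\<dots> \<le> card (?R (insert (x,True) Q) t1) + card (?R (insert (x,False) Q) t0)"
      by (intro add_mono step) auto
    also have "\<dots> = card (?R (insert (x,True) Q) t1 \<union> ?R (insert (x,False) Q) t0)"
      using K by (intro card_Un_disjoint[symmetric]) auto
    also have "?R (insert (x,True) Q) t1 \<union> ?R (insert (x,False) Q) t0 = ?R Q (Query x t0 t1)"
      by auto
    finally show ?thesis .
  qed
qed

text \<open>Two runs are identical until a bad event, and the event is measured in the run with
  \<kappa> alone. That run does not know \<kappa>'; when \<kappa>' carries a secret, the queried
  points are fixed before the secret is averaged, which disposes of adaptivity.\<close>

lemma accepts_key_map_le:
  assumes "finite K"
    and "\<And>x. \<kappa>' x \<in> K \<longleftrightarrow> \<kappa> x \<in> K"
    and "\<And>x y. \<kappa> x = \<kappa> y \<Longrightarrow> \<kappa>' x = \<kappa>' y"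
  shows "card {G \<in> Pow K. accepts t (\<lambda>x. \<kappa> x \<in> G) = \<beta>} \<le>
      card {G \<in> Pow K. accepts t (\<lambda>x. \<kappa>' x \<in> G) = \<beta>} +
      card {G \<in> Pow K. \<not> separated \<kappa> \<kappa>' (query_path t (\<lambda>x. \<kappa> x \<in> G))}"
proof -
  have "card {G \<in> Pow K. accepts t (\<lambda>x. \<kappa> x \<in> G) = \<beta>} \<le>
     card ({G \<in> Pow K. accepts t (\<lambda>x. \<kappa> x \<in> G) = \<beta> \<and>
              separated \<kappa> \<kappa>' (query_path t (\<lambda>x. \<kappa> x \<in> G))} \<union>
           {G \<in> Pow K. \<not> separated \<kappa> \<kappa>' (query_path t (\<lambda>x. \<kappa> x \<in> G))})"
    using assms(1) by (intro card_mono) auto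
  also have "\<dots> \<le> card {G \<in> Pow K. accepts t (\<lambda>x. \<kappa> x \<in> G) = \<beta> \<and>
              separated \<kappa> \<kappa>' (query_path t (\<lambda>x. \<kappa> x \<in> G))} +
           card {G \<in> Pow K. \<not> separated \<kappa> \<kappa>' (query_path t (\<lambda>x. \<kappa> x \<in> G))}"
    by (rule card_Un_le)
  also have "card {G \<in> Pow K. accepts t (\<lambda>x. \<kappa> x \<in> G) = \<beta> \<and>
              separated \<kappa> \<kappa>' (query_path t (\<lambda>x. \<kappa> x \<in> G))} \<le>
      card {G \<in> Pow K. accepts t (\<lambda>x. \<kappa>' x \<in> G) = \<beta>}"
    using accepts_key_map_le_aux[OF assms, where Q = "{}" and t = t and \<beta> = \<beta>] by (simp add: separated_def)
  finally show ?thesis by simp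
qed

section \<open>Functions on the cube\<close>

lemma finite_cube [simp]: "finite (cube n)"
  using finite_lists_length_eq[of "UNIV :: bool set" n] by (simp add: cube_def)

lemma card_cube: "card (cube n) = 2 ^ n"
  using card_lists_length_eq[of "UNIV :: bool set" n] by (simp add: cube_def)

lemma cube_nonempty: "cube n \<noteq> {}"
  using card_cube[of n] by auto

lemma fun_dist_eq_card: "fun_dist n f g = real (card {x \<in> cube n. f x \<noteq> g x}) / 2 ^ n"
  unfolding fun_dist_def
  by (subst measure_pmf_of_set) (auto simp: cube_nonempty card_cube Int_def)

lemma sum_cube_append:
  "(\<Sum>x\<in>cube (p + m). h x) = (\<Sum>u\<in>cube p. \<Sum>d\<in>cube m. h (u @ d))"
proof -
  have "(\<Sum>u\<in>cube p. \<Sum>d\<in>cube m. h (u @ d)) = (\<Sum>(u,d)\<in>cube p \<times> cube m. h (u @ d))"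
    by (rule sum.cartesian_product)
  also have "\<dots> = (\<Sum>x\<in>cube (p + m). h x)"
    by (rule sum.reindex_bij_witness[where i = "\<lambda>x. (take p x, drop p x)" and j = "\<lambda>(u,d). u @ d"])
      (auto simp: cube_def)
  finally show ?thesis by simp
qed

text \<open>\<open>depends_on\<close> speaks of single flips only, so the differing coordinates are
  changed one at a time.\<close>

lemma eq_outside_irrelevant:
  assumes fin: "finite M" and M: "\<And>i. i \<in> M \<Longrightarrow> \<not> depends_on n g i"
    and x: "x \<in> cube n" and y: "y \<in> cube n"
    and eq: "\<And>i. i < n \<Longrightarrow> i \<notin> M \<Longrightarrow> x ! i = y ! i"
  shows "g x = g y"
  using fin M y eq
proof (induction M arbitrary: y rule: finite_induct)
  case empty
  then have "x = y" using x by (intro nth_equalityI) (auto simp: cube_def)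
  then show ?case by simp
next
  case (insert i M)
  show ?case
  proof (cases "i < n \<and> x ! i \<noteq> y ! i")
    case True
    define y' where "y' = y[i := \<not> y ! i]"
    have y': "y' \<in> cube n" using insert.prems by (simp add: y'_def cube_def)
    have "g x = g y'"
    proof (rule insert.IH)
      fix j assume "j < n" "j \<notin> M"
      then show "x ! j = y' ! j"
        using insert.prems True by (cases "j = i") (auto simp: y'_def cube_def)
    qed (use insert.prems y' in auto)
    also have "g y' = g y"
      using insert.prems(1)[of i] insert.prems(2) True by (auto simp: depends_on_def y'_def)
    finally show ?thesis .
  next
    case False
    then show ?thesis using insert.prems by (intro insert.IH) auto
  qed
qed

lemma card_subsets_trace:
  assumes W: "finite W" and H: "H \<subseteq> W" and C: "C \<subseteq> Pow H"
  shows "card {Z \<in> Pow W. Z \<inter> H \<in> C} = card C * 2 ^ (card W - card H)"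
proof -
  have "bij_betw (\<lambda>Z. (Z \<inter> H, Z - H)) {Z \<in> Pow W. Z \<inter> H \<in> C} (C \<times> Pow (W - H))"
  proof -
    have *: "(Y \<union> Z) \<inter> H = Y" "Y \<union> Z - H = Z" "Y \<subseteq> W" "Z \<subseteq> W" if "Y \<in> C" "Z \<subseteq> W - H" for Y Z
      using that C H by auto
    show ?thesis
    proof (rule bij_betw_byWitness[where f' = "\<lambda>(Y,Z). Y \<union> Z"])
      show "(\<lambda>(Y,Z). Y \<union> Z) ` (C \<times> Pow (W - H)) \<subseteq> {Z \<in> Pow W. Z \<inter> H \<in> C}"
      proof
        fix X assume "X \<in> (\<lambda>(Y,Z). Y \<union> Z) ` (C \<times> Pow (W - H))"
        then obtain Y Z where "Y \<in> C" "Z \<subseteq> W - H" "X = Y \<union> Z" by auto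
        then show "X \<in> {Z \<in> Pow W. Z \<inter> H \<in> C}" using * by simp
      qed
    qed (use *(1,2) in auto)
  qed
  then have "card {Z \<in> Pow W. Z \<inter> H \<in> C} = card (C \<times> Pow (W - H))"
    by (rule bij_betw_same_card)
  also have "\<dots> = card C * 2 ^ (card W - card H)"
    using W H by (simp add: card_cartesian_product card_Pow card_Diff_subset finite_subset)
  finally show ?thesis .
qed

section \<open>The construction\<close>

text \<open>
  The first \<open>p\<close> variables form a public address \<open>u\<close>; the others are arranged in \<open>w\<close> blocks of
  \<open>E * u0\<close> variables, and \<open>u\<close> selects the variable \<open>b u j\<close> of block \<open>j\<close>.  Addresses outside
  \<open>Act\<close> carry the value \<open>False\<close>: they only serve to adjust the distance.
\<close>

locale hidden_blocks =
  fixes p w E u0 s :: nat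
    and Act :: "bool list set"
    and b :: "bool list \<Rightarrow> nat \<Rightarrow> nat"
    and C :: "nat set \<Rightarrow> nat set set"
  assumes Act: "Act \<subseteq> cube p" "Act \<noteq> {}"
    and pos: "E > 0" "u0 > 0" "s \<ge> 1"
    and b_less: "\<And>u j. b u j < E * u0"
    and uniform: "\<And>\<phi> :: nat \<Rightarrow> nat \<Rightarrow> real. (\<Sum>u\<in>Act. \<Prod>j<w. \<phi> j (b u j)) =
        real (card Act) * (\<Prod>j<w. (\<Sum>i<E * u0. \<phi> j i) / real (E * u0))"
    and code: "\<And>D. finite D \<Longrightarrow> is_code s D (C D)"
    and code_card: "\<And>D x. finite D \<Longrightarrow> 0 < x \<Longrightarrow> x \<le> 1 \<Longrightarrow>
        2 ^ card D * x ^ (s - 1) \<le> real (card (C D)) * (1 + x) ^ card D"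
begin

definition "v = E * u0"
definition "n = p + w * v"
definition "var u j = p + j * v + b u j"
definition "sel x = {j. j < w \<and> x ! var (take p x) j}"
definition "key x = (take p x, sel x)"
definition "K = Act \<times> Pow {..<w}"
definition "overwrite x Z =
  map (\<lambda>i. if i \<in> var (take p x) ` {..<w} then i \<in> var (take p x) ` Z else x ! i) [0..<n]"

text \<open>
  The secret \<open>\<theta>\<close> selects one of \<open>E\<close> residue classes in each block; \<open>canon \<theta>\<close> identifies the
  codewords on the hidden coordinates with the zero word.
\<close>

definition "hid \<theta> u = {j. j < w \<and> b u j mod E = \<theta> j}"
definition "canon \<theta> \<kappa> = (case \<kappa> of (u, Z) \<Rightarrow>
  (u, if Z \<inter> hid \<theta> u \<in> C (hid \<theta> u) then Z - hid \<theta> u else Z))"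
text \<open>The key map of the junta used for comparison: every hidden word, codeword or not,
  becomes the zero word.\<close>

definition "base \<theta> \<kappa> = (case \<kappa> of (u, Z) \<Rightarrow> (u, Z - hid \<theta> u))"

text \<open>Inactive addresses carry a constant, so the relevant distances scale with this fraction.
  It is the knob that moves the far distance to \<open>\<epsilon>\<^sub>2\<close>.\<close>

definition "dens = real (card Act) / 2 ^ p"

lemma v_pos: "v > 0" using pos by (simp add: v_def)

lemma finite_Act [simp]: "finite Act"
  using Act(1) finite_subset[OF _ finite_cube] by blast

lemma finite_K [simp]: "finite K" by (simp add: K_def)

lemma card_Act_pos: "card Act > 0" using Act(2) by (simp add: card_gt_0_iff)

lemma card_K: "card K = card Act * 2 ^ w"
  by (simp add: K_def card_cartesian_product card_Pow)

lemma card_K_pos: "card K > 0" using card_Act_pos by (simp add: card_K)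

lemma K_nonempty: "K \<noteq> {}" using card_K_pos by auto

lemma finite_hid [simp]: "finite (hid \<theta> u)" and hid_subset: "hid \<theta> u \<subseteq> {..<w}"
  by (auto simp: hid_def)

lemma block_less: "j < w \<Longrightarrow> i < v \<Longrightarrow> p + j * v + i < n"
proof -
  assume "j < w" "i < v"
  then have "j * v + i < (j + 1) * v" by simp
  also have "\<dots> \<le> w * v" using \<open>j < w\<close> by (intro mult_right_mono) auto
  finally show ?thesis by (simp add: n_def)
qed

lemma var_bounds: "j < w \<Longrightarrow> p \<le> var u j \<and> var u j < n"
  using block_less[of j "b u j"] b_less[of u j] by (simp add: var_def v_def)

lemma block_inj: "i < v \<Longrightarrow> i' < v \<Longrightarrow> p + j * v + i = p + j' * v + i' \<Longrightarrow> j = j' \<and> i = i'"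
proof -
  assume i: "i < v" "i' < v" and "p + j * v + i = p + j' * v + i'"
  then have eq: "i + j * v = i' + j' * v" by simp
  have "(i + j * v) div v = j" "(i' + j' * v) div v = j'" using i by auto
  then have "j = j'" using eq by metis
  then show ?thesis using eq by simp
qed

lemma var_inj: "inj (var u)"
proof (rule injI)
  fix j j' assume "var u j = var u j'"
  then show "j = j'" using block_inj[of "b u j" "b u j'" j j'] b_less by (simp add: var_def v_def)
qed

section \<open>Resampling the selected bits\<close>

lemma take_overwrite: "x \<in> cube n \<Longrightarrow> take p (overwrite x Z) = take p x"
proof (rule nth_equalityI)
  assume x: "x \<in> cube n"
  then show "length (take p (overwrite x Z)) = length (take p x)"
    by (simp add: overwrite_def cube_def)
  fix i assume "i < length (take p (overwrite x Z))"
  then have i: "i < p" "i < n" by (auto simp: overwrite_def n_def)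
  then have "i \<notin> var (take p x) ` {..<w}" 
    using var_bounds[of _ "take p x"] by (auto simp: not_le[symmetric])
  then show "take p (overwrite x Z) ! i = take p x ! i"
    using i by (simp add: overwrite_def)
qed

lemma overwrite_cube: "overwrite x Z \<in> cube n"
  by (simp add: overwrite_def cube_def)

lemma sel_overwrite: "x \<in> cube n \<Longrightarrow> Z \<subseteq> {..<w} \<Longrightarrow> sel (overwrite x Z) = Z"
  unfolding sel_def take_overwrite
  using var_bounds inj_image_mem_iff[OF var_inj, of "take p x"]
  by (auto simp: overwrite_def)

lemma overwrite_overwrite: "x \<in> cube n \<Longrightarrow> overwrite (overwrite x Z) (sel x) = x"
proof (rule nth_equalityI)
  assume x: "x \<in> cube n"
  then show "length (overwrite (overwrite x Z) (sel x)) = length x"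
    by (simp add: overwrite_def cube_def)
  fix i assume "i < length (overwrite (overwrite x Z) (sel x))"
  then have i: "i < n" by (simp add: overwrite_def)
  show "overwrite (overwrite x Z) (sel x) ! i = x ! i"
  proof (cases "i \<in> var (take p x) ` {..<w}")
    case True
    then obtain j where j: "j < w" "i = var (take p x) j" by auto
    have "overwrite (overwrite x Z) (sel x) ! i = (i \<in> var (take p x) ` sel x)"
      using i True by (subst overwrite_def) (simp add: take_overwrite[OF x])
    also have "\<dots> = x ! i"
      using j inj_image_mem_iff[OF var_inj, of "take p x" j "sel x"] by (simp add: sel_def)
    finally show ?thesis .
  next
    case False
    then have "overwrite (overwrite x Z) (sel x) ! i = overwrite x Z ! i"
      using i by (subst overwrite_def) (simp add: take_overwrite[OF x])
    then show ?thesis using False i by (simp add: overwrite_def)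
  qed
qed

text \<open>Overwriting keeps the address and hence the selection, so
  \<open>(x, Z) \<mapsto> (overwrite x Z, sel x)\<close> is an involution: a uniform point with its
  selected bits resampled is again uniform.\<close>

lemma sum_overwrite:
  fixes h :: "bool list \<Rightarrow> real"
  shows "(\<Sum>x\<in>cube n. \<Sum>Z\<in>Pow {..<w}. h (overwrite x Z)) = 2 ^ w * (\<Sum>x\<in>cube n. h x)"
proof -
  have sel: "sel x \<subseteq> {..<w}" for x by (auto simp: sel_def)
  have "(\<Sum>x\<in>cube n. \<Sum>Z\<in>Pow {..<w}. h (overwrite x Z)) =
        (\<Sum>(x,Z)\<in>cube n \<times> Pow {..<w}. h (overwrite x Z))"
    by (rule sum.cartesian_product)
  also have "\<dots> = (\<Sum>(x,Z)\<in>cube n \<times> Pow {..<w}. h x)"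
    by (rule sum.reindex_bij_witness[where i = "\<lambda>(x,Z). (overwrite x Z, sel x)"
          and j = "\<lambda>(x,Z). (overwrite x Z, sel x)"])
      (use sel in \<open>auto simp: overwrite_cube overwrite_overwrite sel_overwrite\<close>)
  also have "\<dots> = (\<Sum>x\<in>cube n. \<Sum>Z\<in>Pow {..<w}. h x)"
    by (rule sum.cartesian_product[symmetric])
  also have "\<dots> = 2 ^ w * (\<Sum>x\<in>cube n. h x)"
    by (simp add: card_Pow flip: sum_distrib_left)
  finally show ?thesis .
qed

text \<open>The key of a uniform point is uniform: after resampling, the selected bits are
  independent of the address.\<close>

lemma sum_key:
  fixes h :: "bool list \<times> nat set \<Rightarrow> real"
  shows "2 ^ w * (\<Sum>x\<in>cube n. h (key x)) = 2 ^ (w * v) * (\<Sum>\<kappa>\<in>cube p \<times> Pow {..<w}. h \<kappa>)"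
proof -
  have "2 ^ w * (\<Sum>x\<in>cube n. h (key x)) =
      (\<Sum>x\<in>cube n. \<Sum>Z\<in>Pow {..<w}. h (key (overwrite x Z)))"
    by (rule sum_overwrite[symmetric])
  also have "\<dots> = (\<Sum>x\<in>cube n. \<Sum>Z\<in>Pow {..<w}. h (take p x, Z))"
    by (intro sum.cong refl) (simp add: key_def take_overwrite sel_overwrite)
  also have "\<dots> = (\<Sum>u\<in>cube p. \<Sum>d\<in>cube (w * v). \<Sum>Z\<in>Pow {..<w}. h (u, Z))"
    unfolding n_def sum_cube_append by (intro sum.cong refl) (simp add: cube_def)
  also have "\<dots> = 2 ^ (w * v) * (\<Sum>\<kappa>\<in>cube p \<times> Pow {..<w}. h \<kappa>)"
    by (simp add: card_cube sum.cartesian_product flip: sum_distrib_left)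
  finally show ?thesis .
qed

lemma fun_dist_le_card:
  assumes "\<And>\<kappa>. \<kappa> \<in> cube p \<times> Pow {..<w} \<Longrightarrow> P \<kappa> \<Longrightarrow> \<kappa> \<in> B"
    and "finite B" and "\<And>x. x \<in> cube n \<Longrightarrow> f x \<noteq> g x \<Longrightarrow> P (key x)"
  shows "fun_dist n f g \<le> real (card B) / 2 ^ (p + w)"
proof -
  have "real (card {x \<in> cube n. f x \<noteq> g x}) \<le> real (card {x \<in> cube n. P (key x)})"
    using assms(3) by (intro of_nat_mono card_mono) auto
  also have "\<dots> = (\<Sum>x\<in>cube n. of_bool (P (key x)))"
    by (simp add: of_bool_def sum.If_cases Int_def)
  finally have "2 ^ w * real (card {x \<in> cube n. f x \<noteq> g x}) \<le>
      2 ^ w * (\<Sum>x\<in>cube n. of_bool (P (key x)))" by simp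
  also have "\<dots> = 2 ^ (w * v) * (\<Sum>\<kappa>\<in>cube p \<times> Pow {..<w}. of_bool (P \<kappa>))"
    by (rule sum_key)
  also have "(\<Sum>\<kappa>\<in>cube p \<times> Pow {..<w}. of_bool (P \<kappa>) :: real) =
      real (card {\<kappa> \<in> cube p \<times> Pow {..<w}. P \<kappa>})"
    by (simp add: of_bool_def sum.If_cases Int_def)
  also have "\<dots> \<le> real (card B)"
    using assms(1,2) by (intro of_nat_mono card_mono) auto
  finally have "2 ^ w * real (card {x \<in> cube n. f x \<noteq> g x}) \<le> 2 ^ (w * v) * real (card B)" by simp
  then show ?thesis
    unfolding fun_dist_eq_card by (simp add: n_def power_add field_simps)
qed

section \<open>Closeness to a junta that ignores the secret variables\<close>

text \<open>On the other active keys \<open>canon\<close> and \<open>base\<close> coincide; on these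
  \<open>canon\<close> is the identity, and the bit of the key is compared with that of another
  key.\<close>

definition "Bad \<theta> = {(u, Z) \<in> K. Z \<inter> hid \<theta> u \<notin> C (hid \<theta> u)}"

lemma finite_Bad [simp]: "finite (Bad \<theta>)"
  by (rule finite_subset[OF _ finite_K]) (auto simp: Bad_def)

text \<open>A base key has an empty hidden word, and the empty word is a codeword.\<close>

lemma base_notin_Bad: "base \<theta> \<kappa> \<notin> Bad \<theta>"
proof -
  have "{} \<in> C (hid \<theta> u)" for u using code[of "hid \<theta> u"] by (simp add: is_code_def)
  moreover have "(Z - hid \<theta> u) \<inter> hid \<theta> u = {}" for Z u by auto
  ultimately show ?thesis by (auto simp: base_def Bad_def split: prod.splits)
qed

lemma fun_dist_canon_base:
  assumes "G \<subseteq> K"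
  shows "fun_dist n (\<lambda>x. canon \<theta> (key x) \<in> G) (\<lambda>x. base \<theta> (key x) \<in> G) \<le>
     real (card {\<kappa> \<in> Bad \<theta>. (\<kappa> \<in> G) \<noteq> (base \<theta> \<kappa> \<in> G)}) / 2 ^ (p + w)"
proof (rule fun_dist_le_card[where P = "\<lambda>\<kappa>. (canon \<theta> \<kappa> \<in> G) \<noteq> (base \<theta> \<kappa> \<in> G)"])
  fix \<kappa> assume \<kappa>: "\<kappa> \<in> cube p \<times> Pow {..<w}" and ne: "(canon \<theta> \<kappa> \<in> G) \<noteq> (base \<theta> \<kappa> \<in> G)"
  obtain u Z where uZ: "\<kappa> = (u, Z)" by (cases \<kappa>)
  have nC: "Z \<inter> hid \<theta> u \<notin> C (hid \<theta> u)"
    using ne by (auto simp: uZ canon_def base_def split: if_splits)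
  then have can: "canon \<theta> \<kappa> = \<kappa>" by (simp add: uZ canon_def)
  have "canon \<theta> \<kappa> \<in> K \<or> base \<theta> \<kappa> \<in> K" using ne assms by blast
  then have "u \<in> Act" by (auto simp: uZ canon_def base_def K_def)
  then show "\<kappa> \<in> {\<kappa> \<in> Bad \<theta>. (\<kappa> \<in> G) \<noteq> (base \<theta> \<kappa> \<in> G)}"
    using nC \<kappa> ne can by (auto simp: uZ Bad_def K_def)
qed auto

text \<open>
  The involution \<open>\<tau>\<close> replaces the membership bit of every bad key by its disagreement with the bit
  of its base key, so that the number of disagreements is distributed as the size of a random
  subset of \<open>Bad \<theta>\<close>.
\<close>

lemma card_disagree_tail:
  assumes c: "c \<ge> 0"
  shows "real (card {G \<in> Pow K. real (card (Bad \<theta>)) / 2 + c \<le>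
            real (card {\<kappa> \<in> Bad \<theta>. (\<kappa> \<in> G) \<noteq> (base \<theta> \<kappa> \<in> G)})})
         \<le> 2 ^ card K * exp (- 2 * c\<^sup>2 / real (card K))"
proof -
  define \<tau> where "\<tau> G = sym_diff G {\<kappa> \<in> Bad \<theta>. base \<theta> \<kappa> \<in> G}" for G
  have sub: "Bad \<theta> \<subseteq> K" by (auto simp: Bad_def)
  \<comment> \<open>\<tau> changes only the bits of bad keys, and no base key is bad; both
    applications of \<tau> therefore consult the same base bits and cancel.\<close>
  have base: "base \<theta> \<kappa> \<in> \<tau> G \<longleftrightarrow> base \<theta> \<kappa> \<in> G" for \<kappa> G
    using base_notin_Bad by (simp add: \<tau>_def)
  have invol: "\<tau> (\<tau> G) = G" for G
  proof -
    have "\<tau> (\<tau> G) = sym_diff (\<tau> G) {\<kappa> \<in> Bad \<theta>. base \<theta> \<kappa> \<in> G}"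
      unfolding \<tau>_def[of "\<tau> G"] base ..
    then show ?thesis by (auto simp: \<tau>_def)
  qed
  have inter: "\<tau> G \<inter> Bad \<theta> = {\<kappa> \<in> Bad \<theta>. (\<kappa> \<in> G) \<noteq> (base \<theta> \<kappa> \<in> G)}" for G
    by (auto simp: \<tau>_def)
  have \<tau>K: "G \<subseteq> K \<Longrightarrow> \<tau> G \<subseteq> K" for G using sub by (auto simp: \<tau>_def)
  have "card {G \<in> Pow K. real (card (Bad \<theta>)) / 2 + c \<le>
            real (card {\<kappa> \<in> Bad \<theta>. (\<kappa> \<in> G) \<noteq> (base \<theta> \<kappa> \<in> G)})} \<le>
        card {G \<in> Pow K. real (card (Bad \<theta>)) / 2 + c \<le> real (card (G \<inter> Bad \<theta>))}"
  proof (rule card_inj_on_le[where f = \<tau>])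
    show "inj_on \<tau> {G \<in> Pow K. real (card (Bad \<theta>)) / 2 + c \<le>
            real (card {\<kappa> \<in> Bad \<theta>. (\<kappa> \<in> G) \<noteq> (base \<theta> \<kappa> \<in> G)})}"
      by (rule inj_on_inverseI[where g = \<tau>]) (rule invol)
    show "\<tau> ` {G \<in> Pow K. real (card (Bad \<theta>)) / 2 + c \<le>
            real (card {\<kappa> \<in> Bad \<theta>. (\<kappa> \<in> G) \<noteq> (base \<theta> \<kappa> \<in> G)})} \<subseteq>
        {G \<in> Pow K. real (card (Bad \<theta>)) / 2 + c \<le> real (card (G \<inter> Bad \<theta>))}"
      using \<tau>K inter by auto
  qed simp
  then show ?thesis
    using card_subsets_tail[OF finite_K K_nonempty sub c] by linarith
qed

lemma card_residue_class:
  assumes "t < E"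
  shows "card {i. i < E * u0 \<and> i mod E = t} = u0"
proof -
  have "bij_betw (\<lambda>q. q * E + t) {..<u0} {i. i < E * u0 \<and> i mod E = t}"
  proof (rule bij_betw_byWitness[where f' = "\<lambda>i. i div E"])
    show "(\<lambda>q. q * E + t) ` {..<u0} \<subseteq> {i. i < E * u0 \<and> i mod E = t}"
    proof clarsimp
      fix q assume "q < u0"
      have "q * E + t < (q + 1) * E" using assms by simp
      also have "\<dots> \<le> u0 * E" using \<open>q < u0\<close> by (intro mult_right_mono) auto
      finally show "q * E + t < E * u0 \<and> t mod E = t" using assms by (simp add: mult.commute)
    qed
    show "(\<lambda>i. i div E) ` {i. i < E * u0 \<and> i mod E = t} \<subseteq> {..<u0}"
      by (auto simp: less_mult_imp_div_less mult.commute)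
  qed (use assms in auto)
  then show ?thesis using bij_betw_same_card by fastforce
qed

text \<open>The probability generating function of the number of hidden bits among the selected
  ones: that number is binomial, each block contributing independently with probability
  \<open>1 / E\<close>.\<close>

lemma sum_hid_power:
  fixes z :: real
  assumes \<theta>: "\<And>j. j < w \<Longrightarrow> \<theta> j < E"
  shows "(\<Sum>u\<in>Act. z ^ card (hid \<theta> u)) = real (card Act) * (1 - (1 - z) / real E) ^ w"
proof -
  have E: "real E > 0" "real u0 > 0" using pos by auto
  have "(\<Sum>u\<in>Act. z ^ card (hid \<theta> u)) = (\<Sum>u\<in>Act. \<Prod>j<w. if b u j mod E = \<theta> j then z else 1)"
    by (intro sum.cong refl) (simp add: prod.If_cases hid_def Int_def conj_commute)
  also have "\<dots> = real (card Act) * (\<Prod>j<w. (\<Sum>i<E * u0. if i mod E = \<theta> j then z else 1) / real (E * u0))"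
    by (rule uniform)
  also have "(\<Prod>j<w. (\<Sum>i<E * u0. if i mod E = \<theta> j then z else 1) / real (E * u0)) =
      (\<Prod>j<w. 1 - (1 - z) / real E)"
  proof (rule prod.cong)
    fix j assume "j \<in> {..<w}"
    then have t: "\<theta> j < E" using \<theta> by simp
    have "(\<Sum>i<E * u0. if i mod E = \<theta> j then z else 1) =
          (\<Sum>i<E * u0. 1 - (1 - z) * of_bool (i mod E = \<theta> j))"
      by (intro sum.cong) auto
    also have "\<dots> = real (E * u0) - (1 - z) * (\<Sum>i<E * u0. of_bool (i mod E = \<theta> j))"
      by (simp add: sum_subtractf sum_distrib_left)
    also have "(\<Sum>i<E * u0. of_bool (i mod E = \<theta> j) :: real) = real u0"
      using card_residue_class[OF t] by (simp add: of_bool_def sum.If_cases Int_def)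
    finally show "(\<Sum>i<E * u0. if i mod E = \<theta> j then z else 1) / real (E * u0) = 1 - (1 - z) / real E"
      using E by (simp add: field_simps)
  qed simp
  finally show ?thesis by simp
qed

text \<open>At address \<open>u\<close> the codewords have density at least
  \<open>x ^ (s - 1) * (1 / (1 + x)) ^ card (hid \<theta> u)\<close>. Its mean over the addresses is
  the generating function at \<open>z = 1 / (1 + x)\<close>.\<close>

lemma card_Bad_le:
  fixes x :: real
  assumes \<theta>: "\<And>j. j < w \<Longrightarrow> \<theta> j < E" and x: "0 < x" "x \<le> 1"
  shows "real (card (Bad \<theta>)) \<le> real (card K) * (1 - x ^ (s - 1) * (1 - x / real E) ^ w)"
proof -
  let ?good = "\<lambda>u. {Z \<in> Pow {..<w}. Z \<inter> hid \<theta> u \<in> C (hid \<theta> u)}"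
  have E: "real E \<ge> 1" using pos by auto
  have KB: "K - Bad \<theta> = (SIGMA u:Act. ?good u)" by (auto simp: Bad_def K_def)
  have "2 ^ w * x ^ (s - 1) * (1 / (1 + x)) ^ card (hid \<theta> u) \<le> real (card (?good u))" for u
  proof -
    let ?H = "hid \<theta> u"
    have le: "card ?H \<le> w" using card_mono[OF _ hid_subset[of \<theta> u]] by simp
    have "card (?good u) = card (C ?H) * 2 ^ (w - card ?H)"
      using card_subsets_trace[of "{..<w}" ?H "C ?H"] hid_subset code[of ?H] by (simp add: is_code_def)
    moreover have "2 ^ w = (2::real) ^ card ?H * 2 ^ (w - card ?H)"
      using le by (simp flip: power_add)
    moreover have "2 ^ card ?H * x ^ (s - 1) * (1 / (1 + x)) ^ card ?H \<le> real (card (C ?H))"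
      using code_card[OF finite_hid x, of \<theta> u] x by (simp add: power_one_over field_simps)
    then have "2 ^ (w - card ?H) * (2 ^ card ?H * x ^ (s - 1) * (1 / (1 + x)) ^ card ?H) \<le>
        2 ^ (w - card ?H) * real (card (C ?H))"
      by (intro mult_left_mono) auto
    ultimately show ?thesis by (simp add: mult_ac)
  qed
  then have "(\<Sum>u\<in>Act. 2 ^ w * x ^ (s - 1) * (1 / (1 + x)) ^ card (hid \<theta> u)) \<le> (\<Sum>u\<in>Act. real (card (?good u)))"
    by (intro sum_mono)
  also have "\<dots> = real (card (K - Bad \<theta>))"
    unfolding KB by (subst card_SigmaI) auto
  also have "(\<Sum>u\<in>Act. 2 ^ w * x ^ (s - 1) * (1 / (1 + x)) ^ card (hid \<theta> u)) =
      2 ^ w * x ^ (s - 1) * (real (card Act) * (1 - (1 - 1 / (1 + x)) / real E) ^ w)"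
    by (simp only: sum_hid_power[OF \<theta>] flip: sum_distrib_left)
  finally have 1: "2 ^ w * x ^ (s - 1) * (real (card Act) * (1 - (1 - 1 / (1 + x)) / real E) ^ w)
      \<le> real (card (K - Bad \<theta>))" .
  have "1 - 1 / (1 + x) \<le> x" using x by (simp add: field_simps)
  then have "(1 - 1 / (1 + x)) / real E \<le> x / real E" using E by (intro divide_right_mono) auto
  moreover have "x / real E \<le> 1" using x E by (simp add: field_simps)
  ultimately have "(1 - x / real E) ^ w \<le> (1 - (1 - 1 / (1 + x)) / real E) ^ w"
    by (intro power_mono) auto
  then have "2 ^ w * x ^ (s - 1) * (real (card Act) * (1 - x / real E) ^ w) \<le>
     2 ^ w * x ^ (s - 1) * (real (card Act) * (1 - (1 - 1 / (1 + x)) / real E) ^ w)"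
    using x by (intro mult_left_mono) auto
  with 1 have 2: "real (card K) * (x ^ (s - 1) * (1 - x / real E) ^ w) \<le> real (card (K - Bad \<theta>))"
    by (simp add: card_K mult_ac)
  have sub: "Bad \<theta> \<subseteq> K" by (auto simp: Bad_def)
  have "real (card (K - Bad \<theta>)) = real (card K) - real (card (Bad \<theta>))"
    using card_Diff_subset[OF finite_Bad sub] card_mono[OF finite_K sub] by (simp add: of_nat_diff)
  with 2 show ?thesis by (simp add: algebra_simps)
qed

text \<open>Flipping a variable of a secret residue class can only change a selected bit that
  \<open>base\<close> deletes. What remains is the address and \<open>v - u0\<close> variables per
  block.\<close>

lemma junta_base:
  assumes \<theta>: "\<And>j. j < w \<Longrightarrow> \<theta> j < E"
  shows "junta n (real (p + w * (v - u0))) (\<lambda>x. base \<theta> (key x) \<in> G)"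
proof -
  let ?g = "\<lambda>x. base \<theta> (key x) \<in> G"
  let ?R = "\<lambda>j. {i. i < v \<and> i mod E \<noteq> \<theta> j}"
  let ?S = "{..<p} \<union> (\<Union>j<w. (\<lambda>i. p + j * v + i) ` ?R j)"
  have "{i. depends_on n ?g i} \<subseteq> ?S"
  proof
    fix i assume "i \<in> {i. depends_on n ?g i}"
    then obtain x where i: "i < n" and x: "x \<in> cube n" and ne: "?g (x[i := \<not> x ! i]) \<noteq> ?g x"
      by (auto simp: depends_on_def)
    show "i \<in> ?S"
    proof (rule ccontr)
      assume "i \<notin> ?S"
      then have "i \<notin> {..<p}" and ni: "i \<notin> (\<Union>j<w. (\<lambda>i. p + j * v + i) ` ?R j)"
        by (meson UnI1 UnI2)+
      then have ip: "p \<le> i" by simp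
      let ?u = "take p x"
      have tk: "take p (x[i := \<not> x ! i]) = ?u" using ip by simp
      have "sel (x[i := \<not> x ! i]) - hid \<theta> ?u = sel x - hid \<theta> ?u"
      proof -
        have "(x[i := \<not> x ! i]) ! var ?u j = x ! var ?u j" if j: "j < w" "j \<notin> hid \<theta> ?u" for j
        proof -
          have "b ?u j \<in> ?R j" using j b_less by (auto simp: hid_def v_def)
          then have "var ?u j \<noteq> i" using ni j by (auto simp: var_def)
          then show ?thesis by simp
        qed
        then show ?thesis by (auto simp: sel_def tk)
      qed
      then have "base \<theta> (key (x[i := \<not> x ! i])) = base \<theta> (key x)"
        by (simp add: base_def key_def tk)
      then show False using ne by simp
    qed
  qed
  then have "card {i. depends_on n ?g i} \<le> card ?S" by (intro card_mono) auto
  also have "\<dots> \<le> p + card (\<Union>j<w. (\<lambda>i. p + j * v + i) ` ?R j)"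
    using card_Un_le[of "{..<p}"] by simp
  also have "card (\<Union>j<w. (\<lambda>i. p + j * v + i) ` ?R j) \<le> (\<Sum>j<w. card ((\<lambda>i. p + j * v + i) ` ?R j))"
    by (rule card_UN_le) simp
  also have "\<dots> \<le> (\<Sum>j<w. v - u0)"
  proof (rule sum_mono)
    fix j assume "j \<in> {..<w}"
    then have t: "\<theta> j < E" using \<theta> by simp
    have "card ((\<lambda>i. p + j * v + i) ` ?R j) \<le> card (?R j)" by (rule card_image_le) simp
    also have "card (?R j) = card ({..<v} - {i. i < E * u0 \<and> i mod E = \<theta> j})"
      by (rule arg_cong[where f = card]) (auto simp: v_def)
    also have "\<dots> = v - u0"
      by (subst card_Diff_subset) (auto simp: v_def card_residue_class[OF t])
    finally show "card ((\<lambda>i. p + j * v + i) ` ?R j) \<le> v - u0" .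
  qed
  finally have "card {i. depends_on n ?g i} \<le> p + w * (v - u0)" by simp
  then show ?thesis unfolding junta_def by (rule of_nat_mono)
qed

text \<open>The comparison junta errs on about half of the bad keys, since the compared bits are
  independent coins; \<eta> is the allowance for fluctuations.\<close>

lemma close_whp:
  fixes x \<eta> :: real
  assumes \<theta>: "\<And>j. j < w \<Longrightarrow> \<theta> j < E" and x: "0 < x" "x \<le> 1" and \<eta>: "\<eta> \<ge> 0"
    and k: "real (p + w * (v - u0)) \<le> k"
    and \<epsilon>: "dens * (1 / 2 - x ^ (s - 1) * (1 - x / real E) ^ w / 2 + \<eta>) \<le> \<epsilon>"
  shows "real (card {G \<in> Pow K. \<not> close_to_junta n k \<epsilon> (\<lambda>x. canon \<theta> (key x) \<in> G)})
         \<le> 2 ^ card K * exp (- 2 * \<eta>\<^sup>2 * real (card K))"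
proof -
  let ?N = "real (card K)"
  let ?T = "{G \<in> Pow K. real (card (Bad \<theta>)) / 2 + \<eta> * ?N \<le>
            real (card {\<kappa> \<in> Bad \<theta>. (\<kappa> \<in> G) \<noteq> (base \<theta> \<kappa> \<in> G)})}"
  have N: "?N > 0" using card_K_pos by simp
  have bad: "real (card (Bad \<theta>)) \<le> ?N * (1 - x ^ (s - 1) * (1 - x / real E) ^ w)"
    by (rule card_Bad_le) (use \<theta> x in auto)
  have "{G \<in> Pow K. \<not> close_to_junta n k \<epsilon> (\<lambda>x. canon \<theta> (key x) \<in> G)} \<subseteq> ?T"
  proof (rule ccontr)
    assume "\<not> ?thesis"
    then obtain G where "G \<in> {G \<in> Pow K. \<not> close_to_junta n k \<epsilon> (\<lambda>x. canon \<theta> (key x) \<in> G)}" and "G \<notin> ?T"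
      by (meson subsetI)
    then have G: "G \<subseteq> K" and nc: "\<not> close_to_junta n k \<epsilon> (\<lambda>x. canon \<theta> (key x) \<in> G)"
      and le: "real (card {\<kappa> \<in> Bad \<theta>. (\<kappa> \<in> G) \<noteq> (base \<theta> \<kappa> \<in> G)}) < real (card (Bad \<theta>)) / 2 + \<eta> * ?N"
      by (simp_all add: not_le)
    have "real (card {\<kappa> \<in> Bad \<theta>. (\<kappa> \<in> G) \<noteq> (base \<theta> \<kappa> \<in> G)}) \<le>
        ?N * (1 / 2 - x ^ (s - 1) * (1 - x / real E) ^ w / 2 + \<eta>)"
      using le bad by (simp add: algebra_simps)
    then have "real (card {\<kappa> \<in> Bad \<theta>. (\<kappa> \<in> G) \<noteq> (base \<theta> \<kappa> \<in> G)}) / 2 ^ (p + w) \<le>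
        ?N * (1 / 2 - x ^ (s - 1) * (1 - x / real E) ^ w / 2 + \<eta>) / 2 ^ (p + w)"
      by (rule divide_right_mono) simp
    also have "\<dots> = dens * (1 / 2 - x ^ (s - 1) * (1 - x / real E) ^ w / 2 + \<eta>)"
      by (simp add: card_K dens_def power_add)
    finally have "fun_dist n (\<lambda>x. canon \<theta> (key x) \<in> G) (\<lambda>x. base \<theta> (key x) \<in> G) \<le> \<epsilon>"
      using fun_dist_canon_base[OF G, of \<theta>] \<epsilon> by linarith
    moreover have "junta n k (\<lambda>x. base \<theta> (key x) \<in> G)"
      using junta_base[of \<theta> G, OF \<theta>] k by (simp add: junta_def)
    ultimately show False using nc by (auto simp: close_to_junta_def)
  qed
  then have "real (card {G \<in> Pow K. \<not> close_to_junta n k \<epsilon> (\<lambda>x. canon \<theta> (key x) \<in> G)}) \<le> real (card ?T)"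
    by (intro of_nat_mono card_mono) auto
  also have "\<dots> \<le> 2 ^ card K * exp (- 2 * (\<eta> * ?N)\<^sup>2 / ?N)"
    by (rule card_disagree_tail) (use \<eta> N in simp)
  also have "- 2 * (\<eta> * ?N)\<^sup>2 / ?N = - 2 * \<eta>\<^sup>2 * ?N"
    using N by (simp add: power2_eq_square)
  finally show ?thesis .
qed

section \<open>Distance from all juntas\<close>

text \<open>
  \<open>M\<close> is a set of variables that a junta ignores.  Once the unselected variables are fixed, such a
  junta becomes a set of keys in \<open>Inv M\<close>, which is determined by its trace on \<open>K\<^sub>0 M\<close>; this
  makes the union bound over all juntas affordable.
\<close>

definition "hit M u = {j. j < w \<and> var u j \<in> M}"
definition "Inv M = {F \<in> Pow K. \<forall>(u,Z)\<in>K. (u, Z) \<in> F \<longleftrightarrow> (u, Z - hit M u) \<in> F}"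
definition "K\<^sub>0 M = {(u,Z) \<in> K. Z \<inter> hit M u = {}}"

lemma hit_subset: "hit M u \<subseteq> {..<w}" by (auto simp: hit_def)

lemma finite_K0 [simp]: "finite (K\<^sub>0 M)"
  by (rule finite_subset[OF _ finite_K]) (auto simp: K\<^sub>0_def)

lemma finite_Inv [simp]: "finite (Inv M)"
  by (rule finite_subset[of _ "Pow K"]) (auto simp: Inv_def)

lemma card_Inv_le: "card (Inv M) \<le> 2 ^ card (K\<^sub>0 M)"
proof -
  have mem: "\<kappa> \<in> F \<longleftrightarrow> \<kappa> \<in> K \<and> (fst \<kappa>, snd \<kappa> - hit M (fst \<kappa>)) \<in> F \<inter> K\<^sub>0 M" if "F \<in> Inv M" for F \<kappa>
  proof (cases \<kappa>)
    case (Pair u Z)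
    have "(u, Z - hit M u) \<in> K\<^sub>0 M" if "(u, Z) \<in> K" using that by (auto simp: K\<^sub>0_def K_def)
    then show ?thesis using that Pair unfolding Inv_def by auto
  qed
  have "inj_on (\<lambda>F. F \<inter> K\<^sub>0 M) (Inv M)"
  proof (rule inj_onI)
    fix F F' assume F: "F \<in> Inv M" "F' \<in> Inv M" and eq: "F \<inter> K\<^sub>0 M = F' \<inter> K\<^sub>0 M"
    show "F = F'" by (rule set_eqI) (simp only: mem[OF F(1)] mem[OF F(2)] eq)
  qed
  then have "card (Inv M) \<le> card (Pow (K\<^sub>0 M))"
    by (rule card_inj_on_le) auto
  then show ?thesis by (simp add: card_Pow)
qed

text \<open>The fraction is the mean of \<open>(1 / 2) ^ card (hit M u)\<close>, a product over the
  blocks of \<open>1 - m j / (2 * v)\<close>. By \<open>1 + t \<le> exp t\<close> only the total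
  \<open>card M\<close> matters, so a junta gains nothing by spreading its ignored variables
  unevenly over the blocks.\<close>

lemma card_K0_le:
  assumes M: "M \<subseteq> {p..<n}"
  shows "real (card (K\<^sub>0 M)) \<le> real (card K) * exp (- real (card M) / (2 * real v))"
proof -
  define m where "m j = card {i. i < v \<and> p + j * v + i \<in> M}" for j
  have v: "real v > 0" using v_pos by simp
  have K0: "K\<^sub>0 M = (SIGMA u:Act. {Z \<in> Pow {..<w}. Z \<inter> hit M u \<in> {{}}})"
    by (auto simp: K\<^sub>0_def K_def)
  have "real (card {Z \<in> Pow {..<w}. Z \<inter> hit M u \<in> {{}}}) = 2 ^ w * (1 / 2) ^ card (hit M u)" for u
  proof -
    have le: "card (hit M u) \<le> w" using card_mono[OF _ hit_subset[of M u]] by simp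
    have "card {Z \<in> Pow {..<w}. Z \<inter> hit M u \<in> {{}}} = 2 ^ (w - card (hit M u))"
      using card_subsets_trace[of "{..<w}" "hit M u" "{{}}"] hit_subset by simp
    moreover have "(2::real) ^ w = 2 ^ card (hit M u) * 2 ^ (w - card (hit M u))"
      using le by (simp flip: power_add)
    ultimately show ?thesis by (simp add: power_one_over)
  qed
  then have "real (card (K\<^sub>0 M)) = (\<Sum>u\<in>Act. 2 ^ w * (1 / 2) ^ card (hit M u))"
    unfolding K0 by (subst card_SigmaI) auto
  also have "\<dots> = 2 ^ w * (\<Sum>u\<in>Act. \<Prod>j<w. if p + j * v + b u j \<in> M then 1 / 2 else 1)"
    unfolding sum_distrib_left
    by (intro sum.cong refl) (simp add: prod.If_cases hit_def var_def Int_def conj_commute)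
  also have "(\<Sum>u\<in>Act. \<Prod>j<w. if p + j * v + b u j \<in> M then 1 / 2 else 1 :: real) =
      real (card Act) * (\<Prod>j<w. (\<Sum>i<E * u0. if p + j * v + i \<in> M then 1 / 2 else 1) / real (E * u0))"
    by (rule uniform)
  finally have card_eq: "real (card (K\<^sub>0 M)) = 2 ^ w * (real (card Act) *
      (\<Prod>j<w. (\<Sum>i<E * u0. if p + j * v + i \<in> M then 1 / 2 else 1) / real (E * u0)))" .
  have "(\<Prod>j<w. (\<Sum>i<E * u0. if p + j * v + i \<in> M then 1 / 2 else 1) / real (E * u0)) \<le>
      (\<Prod>j<w. exp (- (real (m j) / (2 * real v))))"
  proof (rule prod_mono, safe)
    fix j
    have "(\<Sum>i<v. if p + j * v + i \<in> M then 1 / 2 else 1 :: real) =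
          (\<Sum>i<v. 1 - of_bool (p + j * v + i \<in> M) / 2)"
      by (intro sum.cong) auto
    also have "\<dots> = real v - (\<Sum>i<v. of_bool (p + j * v + i \<in> M)) / 2"
      by (simp add: sum_subtractf flip: sum_divide_distrib)
    also have "(\<Sum>i<v. of_bool (p + j * v + i \<in> M) :: real) = real (m j)"
      by (simp add: m_def of_bool_def sum.If_cases Int_def)
    finally have "(\<Sum>i<v. if p + j * v + i \<in> M then 1 / 2 else 1 :: real) / real v = 1 + - (real (m j) / (2 * real v))"
      using v by (simp add: field_simps)
    also have "\<dots> \<le> exp (- (real (m j) / (2 * real v)))" by (rule exp_ge_add_one_self)
    finally show "(\<Sum>i<E * u0. if p + j * v + i \<in> M then 1 / 2 else 1 :: real) / real (E * u0) \<le>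
        exp (- (real (m j) / (2 * real v)))" by (simp add: v_def)
  qed (auto intro!: divide_nonneg_nonneg sum_nonneg)
  also have "\<dots> = exp (- (real (\<Sum>j<w. m j) / (2 * real v)))"
    by (simp add: exp_sum[symmetric] sum_negf sum_divide_distrib)
  also have "\<dots> \<le> exp (- real (card M) / (2 * real v))"
  proof -
    have "M \<subseteq> (\<Union>j<w. (\<lambda>i. p + j * v + i) ` {i. i < v \<and> p + j * v + i \<in> M})"
    proof
      fix i assume i: "i \<in> M"
      then have "p \<le> i" "i < n" using M by auto
      define j where "j = (i - p) div v"
      have "i - p < w * v" using \<open>p \<le> i\<close> \<open>i < n\<close> by (simp add: n_def)
      then have j: "j < w" unfolding j_def by (rule less_mult_imp_div_less)
      have "p + j * v + (i - p) mod v = i"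
        unfolding j_def using \<open>p \<le> i\<close> div_mult_mod_eq[of "i - p" v] by linarith
      moreover have "(i - p) mod v < v" using v_pos by simp
      ultimately show "i \<in> (\<Union>j<w. (\<lambda>i. p + j * v + i) ` {i. i < v \<and> p + j * v + i \<in> M})"
        using i j by (intro UN_I[of j] image_eqI[of _ _ "(i - p) mod v"]) auto
    qed
    then have "card M \<le> card (\<Union>j<w. (\<lambda>i. p + j * v + i) ` {i. i < v \<and> p + j * v + i \<in> M})"
      by (intro card_mono) auto
    also have "\<dots> \<le> (\<Sum>j<w. card ((\<lambda>i. p + j * v + i) ` {i. i < v \<and> p + j * v + i \<in> M}))"
      by (rule card_UN_le) simp
    also have "\<dots> \<le> (\<Sum>j<w. m j)"
      unfolding m_def by (intro sum_mono card_image_le) simp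
    finally have "real (card M) / (2 * real v) \<le> real (\<Sum>j<w. m j) / (2 * real v)"
      using v by (intro divide_right_mono of_nat_mono) auto
    then show ?thesis by simp
  qed
  finally have "2 ^ w * (real (card Act) *
      (\<Prod>j<w. (\<Sum>i<E * u0. if p + j * v + i \<in> M then 1 / 2 else 1) / real (E * u0))) \<le>
      2 ^ w * (real (card Act) * exp (- real (card M) / (2 * real v)))"
    by (intro mult_left_mono) auto
  then show ?thesis unfolding card_eq by (simp add: card_K mult_ac)
qed

text \<open>Averaging over the unselected variables: \<open>F d\<close> is what \<open>g\<close>
  computes on keys when the blocks are filled with \<open>d\<close> before the selected bits are
  overwritten. By resampling, the mean distance of \<open>G\<close> to \<open>F d\<close> is at most
  the suitably scaled distance of the functions, so some \<open>d\<close> does as well.\<close>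

lemma invariant_near_if_junta_near:
  assumes G: "G \<subseteq> K" and g: "junta n k' g"
    and near: "fun_dist n (\<lambda>x. key x \<in> G) g < dens * (1 / 2 - \<eta>)"
  shows "\<exists>M. M \<subseteq> {p..<n} \<and> real (w * v) - k' \<le> real (card M) \<and>
     (\<exists>F\<in>Inv M. real (card (sym_diff G F)) \<le> real (card K) / 2 - \<eta> * real (card K))"
proof -
  let ?N = "real (card K)"
  define M where "M = {i \<in> {p..<n}. \<not> depends_on n g i}"
  define F where "F d = {(u,Z) \<in> K. g (overwrite (u @ d) Z)}" for d
  have "{p..<n} \<subseteq> M \<union> {i. depends_on n g i}" by (auto simp: M_def)
  moreover have fd: "finite {i. depends_on n g i}"
    by (rule finite_subset[of _ "{..<n}"]) (auto simp: depends_on_def)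
  ultimately have "card {p..<n} \<le> card (M \<union> {i. depends_on n g i})"
    by (intro card_mono) (auto simp: M_def)
  also have "\<dots> \<le> card M + card {i. depends_on n g i}" by (rule card_Un_le)
  also have "card {p..<n} = w * v" by (simp add: n_def)
  finally have "real (w * v) \<le> real (card M + card {i. depends_on n g i})"
    by (rule of_nat_mono)
  then have cM: "real (w * v) - k' \<le> real (card M)" using g by (simp add: junta_def)
  have FInv: "F d \<in> Inv M" if d: "d \<in> cube (w * v)" for d
  proof -
    have "g (overwrite (u @ d) Z) = g (overwrite (u @ d) (Z - hit M u))" if uZ: "(u, Z) \<in> K" for u Z
    proof (rule eq_outside_irrelevant[where M = M])
      have u: "length u = p" using uZ Act(1) by (auto simp: K_def cube_def)
      show "overwrite (u @ d) Z ! i = overwrite (u @ d) (Z - hit M u) ! i" if i: "i < n" "i \<notin> M" for i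
        using i u uZ by (auto simp: overwrite_def hit_def K_def)
    qed (auto simp: overwrite_cube M_def)
    moreover have "(u, Z - hit M u) \<in> K" if "(u, Z) \<in> K" for u Z
      using that by (auto simp: K_def)
    ultimately show ?thesis by (auto simp: Inv_def F_def)
  qed
  have "\<exists>d\<in>cube (w * v). real (card (sym_diff G (F d))) \<le> ?N / 2 - \<eta> * ?N"
  proof (rule ccontr)
    assume "\<not> ?thesis"
    then have far: "\<And>d. d \<in> cube (w * v) \<Longrightarrow> ?N / 2 - \<eta> * ?N \<le> real (card (sym_diff G (F d)))"
      by (meson less_imp_le not_le)
    have "2 ^ (w * v) * (?N / 2 - \<eta> * ?N) = (\<Sum>d\<in>cube (w * v). ?N / 2 - \<eta> * ?N)"
      by (simp add: card_cube)
    also have "\<dots> \<le> (\<Sum>d\<in>cube (w * v). real (card (sym_diff G (F d))))"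
      by (intro sum_mono far)
    also have "\<dots> \<le> (\<Sum>d\<in>cube (w * v). \<Sum>(u,Z)\<in>cube p \<times> Pow {..<w}.
                     of_bool (((u,Z) \<in> G) \<noteq> g (overwrite (u @ d) Z)))"
    \<comment> \<open>\<open>F d\<close> lives on \<open>K\<close> only, whereas the right side
      counts disagreements at inactive addresses too.\<close>
    proof (rule sum_mono)
      fix d
      let ?X = "{\<kappa> \<in> cube p \<times> Pow {..<w}. (\<kappa> \<in> G) \<noteq> g (overwrite (fst \<kappa> @ d) (snd \<kappa>))}"
      have "sym_diff G (F d) \<subseteq> ?X"
      proof
        fix \<kappa> assume \<kappa>: "\<kappa> \<in> sym_diff G (F d)"
        then have "\<kappa> \<in> K" using G by (auto simp: F_def)
        moreover from this have "\<kappa> \<in> F d \<longleftrightarrow> g (overwrite (fst \<kappa> @ d) (snd \<kappa>))"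
          by (simp add: F_def case_prod_unfold)
        moreover have "\<kappa> \<in> cube p \<times> Pow {..<w}" using \<open>\<kappa> \<in> K\<close> Act(1) by (auto simp: K_def)
        ultimately show "\<kappa> \<in> ?X" using \<kappa> by blast
      qed
      then have "card (sym_diff G (F d)) \<le> card ?X" by (intro card_mono) auto
      moreover have "real (card ?X) = (\<Sum>\<kappa>\<in>cube p \<times> Pow {..<w}.
                     of_bool ((\<kappa> \<in> G) \<noteq> g (overwrite (fst \<kappa> @ d) (snd \<kappa>))))"
        by (simp only: of_bool_def) (simp add: sum.If_cases Int_def)
      ultimately show "real (card (sym_diff G (F d))) \<le> (\<Sum>(u,Z)\<in>cube p \<times> Pow {..<w}.
                     of_bool (((u,Z) \<in> G) \<noteq> g (overwrite (u @ d) Z)))"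
        by (simp only: case_prod_unfold prod.collapse of_nat_le_iff[symmetric, where 'a = real])
    qed
    also have "\<dots> = (\<Sum>d\<in>cube (w * v). \<Sum>u\<in>cube p. \<Sum>Z\<in>Pow {..<w}.
                     of_bool (((u,Z) \<in> G) \<noteq> g (overwrite (u @ d) Z)))"
      by (simp only: sum.cartesian_product)
    also have "\<dots> = (\<Sum>u\<in>cube p. \<Sum>d\<in>cube (w * v). \<Sum>Z\<in>Pow {..<w}.
                     of_bool (((u,Z) \<in> G) \<noteq> g (overwrite (u @ d) Z)))"
      by (rule sum.swap)
    also have "\<dots> = (\<Sum>x\<in>cube n. \<Sum>Z\<in>Pow {..<w}. of_bool (((take p x,Z) \<in> G) \<noteq> g (overwrite x Z)))"
      unfolding n_def sum_cube_append by (intro sum.cong refl) (simp add: cube_def)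
    also have "\<dots> = (\<Sum>x\<in>cube n. \<Sum>Z\<in>Pow {..<w}. of_bool ((key (overwrite x Z) \<in> G) \<noteq> g (overwrite x Z)))"
      by (intro sum.cong refl) (simp add: key_def take_overwrite sel_overwrite)
    also have "\<dots> = 2 ^ w * (\<Sum>x\<in>cube n. of_bool ((key x \<in> G) \<noteq> g x))"
      by (rule sum_overwrite)
    also have "(\<Sum>x\<in>cube n. of_bool ((key x \<in> G) \<noteq> g x)) = real (card {x \<in> cube n. (key x \<in> G) \<noteq> g x})"
      by (simp add: of_bool_def sum.If_cases Int_def)
    finally have "2 ^ (w * v) * (?N * (1 / 2 - \<eta>)) \<le>
        2 ^ w * (2 ^ (p + w * v) * fun_dist n (\<lambda>x. key x \<in> G) g)"
      unfolding fun_dist_eq_card by (simp add: n_def algebra_simps)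
    then have "(2 ^ w * 2 ^ (w * v)) * (real (card Act) * (1 / 2 - \<eta>)) \<le>
        (2 ^ w * 2 ^ (w * v)) * (2 ^ p * fun_dist n (\<lambda>x. key x \<in> G) g)"
      by (simp only: card_K power_add of_nat_mult of_nat_power of_nat_numeral mult_ac)
    then have "real (card Act) * (1 / 2 - \<eta>) \<le> 2 ^ p * fun_dist n (\<lambda>x. key x \<in> G) g"
      by (subst (asm) mult_le_cancel_left_pos) auto
    then have "dens * (1 / 2 - \<eta>) \<le> fun_dist n (\<lambda>x. key x \<in> G) g"
      by (simp add: dens_def field_simps)
    then show False using near by simp
  qed
  then show ?thesis using FInv cM by (intro exI[of _ M]) (auto simp: M_def)
qed

text \<open>Union bound over at most \<open>2 ^ (w * v)\<close> ignored sets \<open>M\<close> and,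
  for each, at most \<open>2 ^ card (K\<^sub>0 M)\<close> invariant sets. The second count and the
  Chernoff exponent are both linear in \<open>card K\<close>, so \<eta> is limited by the fraction
  \<open>exp (- m\<^sub>0 / (2 * v))\<close>.\<close>

lemma far_whp:
  fixes \<eta> m\<^sub>0 :: real
  assumes \<eta>: "\<eta> \<ge> 0" and m0: "m\<^sub>0 \<le> real (w * v) - k'" and \<epsilon>: "\<epsilon> \<le> dens * (1 / 2 - \<eta>)"
  shows "real (card {G \<in> Pow K. \<not> far_from_juntas n k' \<epsilon> (\<lambda>x. key x \<in> G)}) \<le>
     2 ^ card K * exp (real (w * v) + real (card K) * exp (- m\<^sub>0 / (2 * real v)) - 2 * \<eta>\<^sup>2 * real (card K))"
proof -
  let ?N = "real (card K)"
  let ?T = "\<lambda>F. {G \<in> Pow K. real (card (sym_diff G F)) \<le> ?N / 2 - \<eta> * ?N}"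
  let ?Ms = "{M \<in> Pow {p..<n}. m\<^sub>0 \<le> real (card M)}"
  have N: "?N > 0" using card_K_pos by simp
  have v: "real v > 0" using v_pos by simp
  have two: "(2::real) ^ i \<le> exp (real i)" for i
    using power_mono[of 2 "exp 1 :: real" i] exp_ge_add_one_self[of 1] by (simp flip: exp_of_nat_mult)
  have "{G \<in> Pow K. \<not> far_from_juntas n k' \<epsilon> (\<lambda>x. key x \<in> G)} \<subseteq> (\<Union>M\<in>?Ms. \<Union>F\<in>Inv M. ?T F)"
  proof
    fix G assume "G \<in> {G \<in> Pow K. \<not> far_from_juntas n k' \<epsilon> (\<lambda>x. key x \<in> G)}"
    then obtain g where G: "G \<subseteq> K" and g: "junta n k' g" and lt: "fun_dist n (\<lambda>x. key x \<in> G) g < \<epsilon>"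
      by (auto simp: far_from_juntas_def not_le)
    have "fun_dist n (\<lambda>x. key x \<in> G) g < dens * (1 / 2 - \<eta>)" using lt \<epsilon> by linarith
    from invariant_near_if_junta_near[OF G g this]
    obtain M F where "M \<subseteq> {p..<n}" "real (w * v) - k' \<le> real (card M)" "F \<in> Inv M"
      "real (card (sym_diff G F)) \<le> ?N / 2 - \<eta> * ?N" by blast
    then show "G \<in> (\<Union>M\<in>?Ms. \<Union>F\<in>Inv M. ?T F)" using G m0
      by (intro UN_I[of M] UN_I[of F]) auto
  qed
  then have "real (card {G \<in> Pow K. \<not> far_from_juntas n k' \<epsilon> (\<lambda>x. key x \<in> G)}) \<le>
      real (card (\<Union>M\<in>?Ms. \<Union>F\<in>Inv M. ?T F))"
    by (intro of_nat_mono card_mono) auto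
  also have "\<dots> \<le> (\<Sum>M\<in>?Ms. real (card (\<Union>F\<in>Inv M. ?T F)))"
    using card_UN_le[of ?Ms "\<lambda>M. \<Union>F\<in>Inv M. ?T F"] by (simp flip: of_nat_sum)
  also have "\<dots> \<le> (\<Sum>M\<in>?Ms. exp (?N * exp (- m\<^sub>0 / (2 * real v))) * (2 ^ card K * exp (- 2 * \<eta>\<^sup>2 * ?N)))"
  proof (rule sum_mono)
    fix M assume M: "M \<in> ?Ms"
    have T: "real (card (?T F)) \<le> 2 ^ card K * exp (- 2 * \<eta>\<^sup>2 * ?N)" if "F \<in> Inv M" for F
    proof -
      have "F \<subseteq> K" using that by (auto simp: Inv_def)
      then have "real (card (?T F)) \<le> 2 ^ card K * exp (- 2 * (\<eta> * ?N)\<^sup>2 / ?N)"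
        by (intro card_subsets_near finite_K K_nonempty) (use \<eta> N in auto)
      also have "- 2 * (\<eta> * ?N)\<^sup>2 / ?N = - 2 * \<eta>\<^sup>2 * ?N"
        using N by (simp add: power2_eq_square)
      finally show ?thesis .
    qed
    have "real (card (\<Union>F\<in>Inv M. ?T F)) \<le> (\<Sum>F\<in>Inv M. real (card (?T F)))"
      using card_UN_le[of "Inv M" ?T] by (simp flip: of_nat_sum)
    also have "\<dots> \<le> (\<Sum>F\<in>Inv M. 2 ^ card K * exp (- 2 * \<eta>\<^sup>2 * ?N))"
      by (intro sum_mono T)
    also have "\<dots> = real (card (Inv M)) * (2 ^ card K * exp (- 2 * \<eta>\<^sup>2 * ?N))" by simp
    also have "\<dots> \<le> exp (?N * exp (- m\<^sub>0 / (2 * real v))) * (2 ^ card K * exp (- 2 * \<eta>\<^sup>2 * ?N))"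
    proof (rule mult_right_mono)
      have "real (card (Inv M)) \<le> 2 ^ card (K\<^sub>0 M)"
        using of_nat_mono[OF card_Inv_le[of M], where 'a = real] by simp
      also have "\<dots> \<le> exp (real (card (K\<^sub>0 M)))" by (rule two)
      also have "real (card (K\<^sub>0 M)) \<le> ?N * exp (- real (card M) / (2 * real v))"
        using M by (intro card_K0_le) auto
      also have "\<dots> \<le> ?N * exp (- m\<^sub>0 / (2 * real v))"
        using M v N by (auto simp: divide_right_mono)
      finally show "real (card (Inv M)) \<le> exp (?N * exp (- m\<^sub>0 / (2 * real v)))" by simp
    qed simp
    finally show "real (card (\<Union>F\<in>Inv M. ?T F)) \<le>
      exp (?N * exp (- m\<^sub>0 / (2 * real v))) * (2 ^ card K * exp (- 2 * \<eta>\<^sup>2 * ?N))" .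
  qed
  also have "\<dots> = real (card ?Ms) * (exp (?N * exp (- m\<^sub>0 / (2 * real v))) * (2 ^ card K * exp (- 2 * \<eta>\<^sup>2 * ?N)))"
    by simp
  also have "\<dots> \<le> exp (real (w * v)) * (exp (?N * exp (- m\<^sub>0 / (2 * real v))) * (2 ^ card K * exp (- 2 * \<eta>\<^sup>2 * ?N)))"
  proof (rule mult_right_mono)
    have "card ?Ms \<le> card (Pow {p..<n})" by (intro card_mono) auto
    also have "\<dots> = 2 ^ (w * v)" by (simp add: card_Pow n_def)
    finally have "real (card ?Ms) \<le> real (2 ^ (w * v))" by (rule of_nat_mono)
    also have "real (2 ^ (w * v)) = 2 ^ (w * v)" by simp
    also have "\<dots> \<le> exp (real (w * v))" by (rule two)
    finally show "real (card ?Ms) \<le> exp (real (w * v))" .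
  qed simp
  also have "\<dots> = 2 ^ card K * exp (real (w * v) + ?N * exp (- m\<^sub>0 / (2 * real v)) - 2 * \<eta>\<^sup>2 * ?N)"
  proof -
    have *: "exp A * (exp B * (c * exp D)) = c * exp (A + B + D)" for A B c D :: real
      by (simp add: exp_add mult_ac)
    show ?thesis unfolding * by simp
  qed
  finally show ?thesis .
qed

section \<open>Hiding the secret from few queries\<close>

definition "\<Theta> = (\<Pi>\<^sub>E j\<in>{..<w}. {..<E})"

lemma finite_Theta [simp]: "finite \<Theta>" by (simp add: \<Theta>_def finite_PiE)

lemma card_Theta: "card \<Theta> = E ^ w" by (simp add: \<Theta>_def card_PiE)

lemma Theta_less: "\<theta> \<in> \<Theta> \<Longrightarrow> j < w \<Longrightarrow> \<theta> j < E"
  by (auto simp: \<Theta>_def PiE_iff)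

lemma sel_subset: "sel x \<subseteq> {..<w}" by (auto simp: sel_def)

lemma canon_key_in_K: "canon \<theta> (key x) \<in> K \<longleftrightarrow> key x \<in> K"
  using sel_subset[of x] by (auto simp: canon_def key_def K_def)

text \<open>Two keys can only be merged if both hidden words are codewords, whose distance is at
  least \<open>s\<close>; outside the hidden positions nothing is changed.\<close>

lemma canon_collision:
  assumes ne: "(u, Z) \<noteq> (u', Z')" and eq: "canon \<theta> (u, Z) = canon \<theta> (u', Z')"
  shows "u = u'" "sym_diff Z Z' \<subseteq> hid \<theta> u" "s \<le> card (sym_diff Z Z')"
proof -
  let ?H = "hid \<theta> u"
  show u: "u = u'" using eq by (simp add: canon_def split: if_splits)
  have C: "is_code s ?H (C ?H)" by (rule code) simp
  then have empty: "{} \<in> C ?H" by (simp add: is_code_def)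
  have Z: "Z \<noteq> Z'" using ne u by simp
  have in_C: "Z \<inter> ?H \<in> C ?H \<and> Z' \<inter> ?H \<in> C ?H \<and> Z - ?H = Z' - ?H"
  \<comment> \<open>In the mixed cases the non-codeword side would have an empty hidden word, which
    is a codeword after all.\<close>
  proof (cases "Z \<inter> ?H \<in> C ?H"; cases "Z' \<inter> ?H \<in> C ?H")
    assume a: "Z \<inter> ?H \<in> C ?H" "Z' \<inter> ?H \<notin> C ?H"
    then have "Z' = Z - ?H" using eq u by (simp add: canon_def)
    then have "Z' \<inter> ?H = {}" by auto
    then show ?thesis using a empty by simp
  next
    assume a: "Z \<inter> ?H \<notin> C ?H" "Z' \<inter> ?H \<in> C ?H"
    then have "Z = Z' - ?H" using eq u by (simp add: canon_def)
    then have "Z \<inter> ?H = {}" by auto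
    then show ?thesis using a empty by simp
  qed (use eq u Z in \<open>simp_all add: canon_def\<close>)
  then show "sym_diff Z Z' \<subseteq> ?H" by blast
  have "sym_diff (Z \<inter> ?H) (Z' \<inter> ?H) = sym_diff Z Z'" "Z \<inter> ?H \<noteq> Z' \<inter> ?H" using in_C Z by blast+
  then show "s \<le> card (sym_diff Z Z')" using C in_C unfolding is_code_def by metis
qed

text \<open>A collision forces the value of \<open>\<theta> j\<close> in every block where the two
  words differ. These blocks do not depend on \<theta>, and there are at least \<open>s\<close> of
  them.\<close>

lemma card_collision_le:
  "card {\<theta> \<in> \<Theta>. key x \<noteq> key y \<and> canon \<theta> (key x) = canon \<theta> (key y)} * E ^ s \<le> E ^ w"
proof -
  let ?S = "{\<theta> \<in> \<Theta>. key x \<noteq> key y \<and> canon \<theta> (key x) = canon \<theta> (key y)}"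
  define \<Delta> u where "\<Delta> = sym_diff (sel x) (sel y)" and "u = take p x"
  have sub: "\<Delta> \<subseteq> {..<w}" using sel_subset[of x] sel_subset[of y] unfolding \<Delta>_def by blast
  have coll: "\<Delta> \<subseteq> hid \<theta> u \<and> s \<le> card \<Delta>" if "\<theta> \<in> ?S" for \<theta>
  proof -
    have "key x \<noteq> key y" "canon \<theta> (key x) = canon \<theta> (key y)" using that by auto
    then show ?thesis
      unfolding key_def \<Delta>_def u_def by (intro conjI canon_collision(2,3))
  qed
  show ?thesis
  proof (cases "?S = {}")
    case False
    then have s: "s \<le> card \<Delta>" using coll by blast
    have "?S \<subseteq> (\<Pi>\<^sub>E j\<in>{..<w}. if j \<in> \<Delta> then {b u j mod E} else {..<E})"
    proof
      fix \<theta> assume t: "\<theta> \<in> ?S"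
      then have "\<theta> j = b u j mod E" if "j \<in> \<Delta>" for j using coll[OF t] that by (auto simp: hid_def)
      then show "\<theta> \<in> (\<Pi>\<^sub>E j\<in>{..<w}. if j \<in> \<Delta> then {b u j mod E} else {..<E})"
        using t by (auto simp: \<Theta>_def PiE_iff)
    qed
    then have "card ?S \<le> card (\<Pi>\<^sub>E j\<in>{..<w}. if j \<in> \<Delta> then {b u j mod E} else {..<E})"
      by (intro card_mono finite_PiE) auto
    also have "\<dots> = (\<Prod>j<w. if j \<in> \<Delta> then 1 else E)"
      by (simp add: card_PiE if_distrib cong: if_cong)
    also have "\<dots> = E ^ card ({..<w} - \<Delta>)"
      by (simp add: prod.If_cases Diff_eq)
    also have "card ({..<w} - \<Delta>) = w - card \<Delta>"
      using sub by (simp add: card_Diff_subset finite_subset)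
    finally have "card ?S * E ^ s \<le> E ^ (w - card \<Delta>) * E ^ card \<Delta>"
      using s pos by (intro mult_mono power_increasing) auto
    also have "\<dots> = E ^ w"
      using card_mono[OF _ sub] by (simp flip: power_add)
    finally show ?thesis .
  qed (simp only: card.empty mult_zero_left zero_le)
qed

lemma card_not_separated_le:
  assumes X: "finite X" "card X \<le> q"
  shows "card {\<theta> \<in> \<Theta>. \<not> separated key (\<lambda>x. canon \<theta> (key x)) X} * E ^ s \<le> q\<^sup>2 * E ^ w"
proof -
  let ?S = "\<lambda>(x,y). {\<theta> \<in> \<Theta>. key x \<noteq> key y \<and> canon \<theta> (key x) = canon \<theta> (key y)}"
  have "{\<theta> \<in> \<Theta>. \<not> separated key (\<lambda>x. canon \<theta> (key x)) X} \<subseteq> (\<Union>xy\<in>X \<times> X. ?S xy)"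
    by (auto simp: separated_def)
  then have "card {\<theta> \<in> \<Theta>. \<not> separated key (\<lambda>x. canon \<theta> (key x)) X} \<le> card (\<Union>xy\<in>X \<times> X. ?S xy)"
    using X by (intro card_mono) auto
  also have "\<dots> \<le> (\<Sum>xy\<in>X \<times> X. card (?S xy))"
    using X by (intro card_UN_le) auto
  finally have "card {\<theta> \<in> \<Theta>. \<not> separated key (\<lambda>x. canon \<theta> (key x)) X} * E ^ s \<le>
      (\<Sum>xy\<in>X \<times> X. card (?S xy)) * E ^ s" by simp
  also have "\<dots> = (\<Sum>xy\<in>X \<times> X. card (?S xy) * E ^ s)" by (rule sum_distrib_right)
  also have "\<dots> \<le> (\<Sum>xy\<in>X \<times> X. E ^ w)"
    by (intro sum_mono) (use card_collision_le in auto)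
  also have "\<dots> = (card X)\<^sup>2 * E ^ w" by (simp add: card_cartesian_product power2_eq_square)
  also have "\<dots> \<le> q\<^sup>2 * E ^ w" using X by (intro mult_right_mono power_mono) auto
  finally show ?thesis .
qed

text \<open>For the failure event the sums over \<theta> and \<open>G\<close> are exchanged: with
  \<open>G\<close> fixed, the run with \<open>key\<close> queries a fixed set of at most
  \<open>q\<close> points, and the collision count over \<theta> applies to its pairs.\<close>

lemma sum_reject_le:
  assumes q: "\<And>f. num_queries t f \<le> q"
  shows "real (card \<Theta>) * (\<Sum>G\<in>Pow K. of_bool (\<not> accepts t (\<lambda>x. key x \<in> G))) \<le>
     (\<Sum>\<theta>\<in>\<Theta>. \<Sum>G\<in>Pow K. of_bool (\<not> accepts t (\<lambda>x. canon \<theta> (key x) \<in> G))) +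
     2 ^ card K * (real q)\<^sup>2 * real E ^ w / real E ^ s"
proof -
  let ?ns = "\<lambda>\<theta> G. \<not> separated key (\<lambda>x. canon \<theta> (key x)) (query_path t (\<lambda>x. key x \<in> G))"
  have ind: "(\<Sum>G\<in>Pow K. of_bool (P G) :: real) = real (card {G \<in> Pow K. P G})" for P
    by (simp add: of_bool_def sum.If_cases Int_def)
  have le: "(\<Sum>G\<in>Pow K. of_bool (\<not> accepts t (\<lambda>x. key x \<in> G)) :: real) \<le>
      (\<Sum>G\<in>Pow K. of_bool (\<not> accepts t (\<lambda>x. canon \<theta> (key x) \<in> G))) + (\<Sum>G\<in>Pow K. of_bool (?ns \<theta> G))" for \<theta>
  proof -
    have "card {G \<in> Pow K. accepts t (\<lambda>x. key x \<in> G) = False} \<le>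
      card {G \<in> Pow K. accepts t (\<lambda>x. canon \<theta> (key x) \<in> G) = False} + card {G \<in> Pow K. ?ns \<theta> G}"
      by (rule accepts_key_map_le) (simp_all only: finite_K canon_key_in_K)
    then show ?thesis unfolding ind eq_False by (simp only: of_nat_add[symmetric] of_nat_le_iff)
  qed
  have "real (card \<Theta>) * (\<Sum>G\<in>Pow K. of_bool (\<not> accepts t (\<lambda>x. key x \<in> G))) =
      (\<Sum>\<theta>\<in>\<Theta>. \<Sum>G\<in>Pow K. of_bool (\<not> accepts t (\<lambda>x. key x \<in> G)))" by simp
  also have "\<dots> \<le> (\<Sum>\<theta>\<in>\<Theta>. (\<Sum>G\<in>Pow K. of_bool (\<not> accepts t (\<lambda>x. canon \<theta> (key x) \<in> G))) +
      (\<Sum>G\<in>Pow K. of_bool (?ns \<theta> G)))"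
    by (intro sum_mono le)
  also have "\<dots> = (\<Sum>\<theta>\<in>\<Theta>. \<Sum>G\<in>Pow K. of_bool (\<not> accepts t (\<lambda>x. canon \<theta> (key x) \<in> G))) +
      (\<Sum>\<theta>\<in>\<Theta>. \<Sum>G\<in>Pow K. of_bool (?ns \<theta> G))"
    by (rule sum.distrib)
  also have "(\<Sum>\<theta>\<in>\<Theta>. \<Sum>G\<in>Pow K. of_bool (?ns \<theta> G) :: real) = (\<Sum>G\<in>Pow K. \<Sum>\<theta>\<in>\<Theta>. of_bool (?ns \<theta> G))"
    by (rule sum.swap)
  also have "\<dots> \<le> (\<Sum>G\<in>Pow K. (real q)\<^sup>2 * real E ^ w / real E ^ s)"
  proof (rule sum_mono)
    fix G
    let ?X = "query_path t (\<lambda>x. key x \<in> G)"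
    have "finite ?X" "card ?X \<le> q"
      using query_path_card_le[of t "\<lambda>x. key x \<in> G"] q[of "\<lambda>x. key x \<in> G"] by auto
    then have "real (card {\<theta> \<in> \<Theta>. ?ns \<theta> G} * E ^ s) \<le> real (q\<^sup>2 * E ^ w)"
      by (intro of_nat_mono card_not_separated_le)
    then have "real (card {\<theta> \<in> \<Theta>. ?ns \<theta> G}) \<le> (real q)\<^sup>2 * real E ^ w / real E ^ s"
      using pos by (simp add: field_simps)
    then show "(\<Sum>\<theta>\<in>\<Theta>. of_bool (?ns \<theta> G)) \<le> (real q)\<^sup>2 * real E ^ w / real E ^ s"
      by (simp add: of_bool_def sum.If_cases Int_def)
  qed
  also have "\<dots> = 2 ^ card K * (real q)\<^sup>2 * real E ^ w / real E ^ s"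
    by (simp add: card_Pow)
  finally show ?thesis by simp
qed

lemma sum_prob_reject_le:
  assumes q: "\<And>t f. t \<in> set_pmf T \<Longrightarrow> num_queries t f \<le> q"
  shows "real (card \<Theta>) * (\<Sum>G\<in>Pow K. measure_pmf.prob T {t. \<not> accepts t (\<lambda>x. key x \<in> G)}) \<le>
     (\<Sum>\<theta>\<in>\<Theta>. \<Sum>G\<in>Pow K. measure_pmf.prob T {t. \<not> accepts t (\<lambda>x. canon \<theta> (key x) \<in> G)}) +
     2 ^ card K * (real q)\<^sup>2 * real E ^ w / real E ^ s"
proof -
  have int: "integrable (measure_pmf T) (\<lambda>t. of_bool (P t) :: real)" for P
    by (rule measure_pmf.integrable_const_bound[where B = 1]) auto
  have prob: "measure_pmf.prob T {t. P t} = measure_pmf.expectation T (\<lambda>t. of_bool (P t))" for P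
  proof -
    have "(\<lambda>t. of_bool (P t) :: real) = indicator {t. P t}" by (auto simp: indicator_def)
    then show ?thesis by simp
  qed
  have s1: "measure_pmf.expectation T (\<lambda>t. \<Sum>G\<in>Pow K. of_bool (P G t)) =
      (\<Sum>G\<in>Pow K. measure_pmf.prob T {t. P G t})" for P
    unfolding prob by (rule Bochner_Integration.integral_sum) (rule int)
  have s2: "measure_pmf.expectation T (\<lambda>t. \<Sum>\<theta>\<in>\<Theta>. \<Sum>G\<in>Pow K. of_bool (P \<theta> G t)) =
      (\<Sum>\<theta>\<in>\<Theta>. \<Sum>G\<in>Pow K. measure_pmf.prob T {t. P \<theta> G t})" for P
    unfolding s1[symmetric]
    by (rule Bochner_Integration.integral_sum) (intro Bochner_Integration.integrable_sum int)
  have "measure_pmf.expectation T (\<lambda>t. real (card \<Theta>) * (\<Sum>G\<in>Pow K. of_bool (\<not> accepts t (\<lambda>x. key x \<in> G)))) \<le>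
     measure_pmf.expectation T (\<lambda>t. (\<Sum>\<theta>\<in>\<Theta>. \<Sum>G\<in>Pow K. of_bool (\<not> accepts t (\<lambda>x. canon \<theta> (key x) \<in> G))) +
     2 ^ card K * (real q)\<^sup>2 * real E ^ w / real E ^ s)"
  proof (rule integral_mono_AE)
    show "AE t in measure_pmf T. real (card \<Theta>) * (\<Sum>G\<in>Pow K. of_bool (\<not> accepts t (\<lambda>x. key x \<in> G))) \<le>
      (\<Sum>\<theta>\<in>\<Theta>. \<Sum>G\<in>Pow K. of_bool (\<not> accepts t (\<lambda>x. canon \<theta> (key x) \<in> G))) +
     2 ^ card K * (real q)\<^sup>2 * real E ^ w / real E ^ s"
      by (subst AE_measure_pmf_iff) (intro ballI sum_reject_le q)
  qed (intro Bochner_Integration.integrable_add Bochner_Integration.integrable_sum integrable_mult_right int; simp)+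
  moreover have "measure_pmf.expectation T (\<lambda>t. (\<Sum>\<theta>\<in>\<Theta>. \<Sum>G\<in>Pow K. of_bool (\<not> accepts t (\<lambda>x. canon \<theta> (key x) \<in> G))) +
      2 ^ card K * (real q)\<^sup>2 * real E ^ w / real E ^ s) =
      measure_pmf.expectation T (\<lambda>t. \<Sum>\<theta>\<in>\<Theta>. \<Sum>G\<in>Pow K. of_bool (\<not> accepts t (\<lambda>x. canon \<theta> (key x) \<in> G))) +
      measure_pmf.expectation T (\<lambda>t. 2 ^ card K * (real q)\<^sup>2 * real E ^ w / real E ^ s)"
    by (rule Bochner_Integration.integral_add)
      (intro Bochner_Integration.integrable_sum int, simp)
  moreover have "measure_pmf.expectation T (\<lambda>t. 2 ^ card K * (real q)\<^sup>2 * real E ^ w / real E ^ s) =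
      2 ^ card K * (real q)\<^sup>2 * real E ^ w / real E ^ s" by simp
  ultimately show ?thesis
    by (simp only: integral_mult_right_zero s1 s2)
qed

text \<open>On average a tester rejects the far instances with probability at least
  \<open>9 / 10 * (2 / 3)\<close> and the close ones with at most \<open>1 / 3 + 1 / 10\<close>,
  while collisions can account for at most \<open>q\<^sup>2 / E ^ s\<close>. The summand 3 in the
  last hypothesis makes each kind of instance fail with probability at most
  \<open>exp (- 3) \<le> 1 / 10\<close>.\<close>

lemma queries_lower_bound:
  fixes x \<eta> m\<^sub>0 :: real
  assumes tester: "is_junta_tester k k' \<epsilon>\<^sub>1 \<epsilon>\<^sub>2 A"
    and q: "\<And>t f. t \<in> set_pmf (A n) \<Longrightarrow> num_queries t f \<le> q"
    and x: "0 < x" "x \<le> 1" and \<eta>: "\<eta> \<ge> 0"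
    and k: "real (p + w * (v - u0)) \<le> k" and m0: "m\<^sub>0 \<le> real (w * v) - k'"
    and \<epsilon>\<^sub>1: "dens * (1 / 2 - x ^ (s - 1) * (1 - x / real E) ^ w / 2 + \<eta>) \<le> \<epsilon>\<^sub>1"
    and \<epsilon>\<^sub>2: "\<epsilon>\<^sub>2 \<le> dens * (1 / 2 - \<eta>)"
    and small: "real (w * v) + real (card K) * exp (- m\<^sub>0 / (2 * real v)) + 3 \<le> 2 * \<eta>\<^sup>2 * real (card K)"
  shows "real E ^ s \<le> 10 * (real q)\<^sup>2"
proof -
  let ?N = "2 ^ card K :: real"
  let ?R = "\<lambda>f. measure_pmf.prob (A n) {t. \<not> accepts t f}"
  have e3: "exp (- 3 :: real) \<le> 1 / 10"
  proof -
    have "(10::real) \<le> (5 / 2) ^ 3" by (simp add: power3_eq_cube)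
    also have "\<dots> \<le> exp 1 ^ 3"
      using exp_lower_Taylor_quadratic[of 1] by (intro power_mono) auto
    also have "\<dots> = exp 3" by (simp flip: exp_of_nat_mult)
    finally show ?thesis by (simp add: exp_minus field_simps)
  qed
  have cardP: "real (card (Pow K)) = ?N" by (simp add: card_Pow)
  have far: "real (card {G \<in> Pow K. \<not> far_from_juntas n k' \<epsilon>\<^sub>2 (\<lambda>x. key x \<in> G)}) \<le> ?N / 10"
  proof -
    have "real (card {G \<in> Pow K. \<not> far_from_juntas n k' \<epsilon>\<^sub>2 (\<lambda>x. key x \<in> G)}) \<le>
      ?N * exp (real (w * v) + real (card K) * exp (- m\<^sub>0 / (2 * real v)) - 2 * \<eta>\<^sup>2 * real (card K))"
      by (rule far_whp[OF \<eta> m0 \<epsilon>\<^sub>2])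
    also have "\<dots> \<le> ?N * exp (- 3)" using small by (intro mult_left_mono) auto
    also have "\<dots> \<le> ?N * (1 / 10)" using e3 by (intro mult_left_mono) auto
    finally show ?thesis by simp
  qed
  have close: "real (card {G \<in> Pow K. \<not> close_to_junta n k \<epsilon>\<^sub>1 (\<lambda>x. canon \<theta> (key x) \<in> G)}) \<le> ?N / 10"
    if "\<theta> \<in> \<Theta>" for \<theta>
  proof -
    have "real (card {G \<in> Pow K. \<not> close_to_junta n k \<epsilon>\<^sub>1 (\<lambda>x. canon \<theta> (key x) \<in> G)}) \<le>
      ?N * exp (- 2 * \<eta>\<^sup>2 * real (card K))"
      by (rule close_whp[where x = x]) (use Theta_less[OF that] x \<eta> k \<epsilon>\<^sub>1 in auto)
    also have "\<dots> \<le> ?N * exp (- 3)"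
    proof -
      have "0 \<le> real (w * v) + real (card K) * exp (- m\<^sub>0 / (2 * real v))" by simp
      then have "3 \<le> 2 * \<eta>\<^sup>2 * real (card K)" using small by linarith
      then show ?thesis by (intro mult_left_mono) auto
    qed
    also have "\<dots> \<le> ?N * (1 / 10)" using e3 by (intro mult_left_mono) auto
    finally show ?thesis by simp
  qed
  have no: "?N * (9 / 10) * (2 / 3) \<le> (\<Sum>G\<in>Pow K. ?R (\<lambda>x. key x \<in> G))"
  proof -
    let ?S = "{G \<in> Pow K. far_from_juntas n k' \<epsilon>\<^sub>2 (\<lambda>x. key x \<in> G)}"
    have "?S = Pow K - {G \<in> Pow K. \<not> far_from_juntas n k' \<epsilon>\<^sub>2 (\<lambda>x. key x \<in> G)}" by auto
    then have "card ?S = card (Pow K) - card {G \<in> Pow K. \<not> far_from_juntas n k' \<epsilon>\<^sub>2 (\<lambda>x. key x \<in> G)}"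
      by (simp only:) (rule card_Diff_subset, auto intro: finite_subset[of _ "Pow K"])
    then have "?N * (9 / 10) \<le> real (card ?S)" using far cardP by linarith
    then have "?N * (9 / 10) * (2 / 3) \<le> real (card ?S) * (2 / 3)" by simp
    also have "\<dots> = (\<Sum>G\<in>?S. 2 / 3)" by simp
    also have "\<dots> \<le> (\<Sum>G\<in>?S. ?R (\<lambda>x. key x \<in> G))"
      using tester by (intro sum_mono) (auto simp: is_junta_tester_def)
    also have "\<dots> \<le> (\<Sum>G\<in>Pow K. ?R (\<lambda>x. key x \<in> G))"
      by (intro sum_mono2) auto
    finally show ?thesis .
  qed
  have yes: "(\<Sum>G\<in>Pow K. ?R (\<lambda>x. canon \<theta> (key x) \<in> G)) \<le> ?N * (1 / 3 + 1 / 10)" if \<theta>: "\<theta> \<in> \<Theta>" for \<theta>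
  proof -
    let ?f = "\<lambda>G x. canon \<theta> (key x) \<in> G"
    have "?R (?f G) \<le> 1 / 3 + of_bool (\<not> close_to_junta n k \<epsilon>\<^sub>1 (?f G))" for G
    proof (cases "close_to_junta n k \<epsilon>\<^sub>1 (?f G)")
      case True
      then have "2 / 3 \<le> measure_pmf.prob (A n) {t. accepts t (?f G)}"
        using tester by (auto simp: is_junta_tester_def)
      moreover have "?R (?f G) = 1 - measure_pmf.prob (A n) {t. accepts t (?f G)}"
        using measure_pmf.prob_compl[of "{t. accepts t (?f G)}" "A n"] by (simp add: Compl_eq[symmetric] Compl_eq_Diff_UNIV[symmetric] Collect_neg_eq)
      ultimately show ?thesis using True by simp
    next
      case False
      have "?R (?f G) \<le> 1" by (rule measure_pmf.prob_le_1)
      moreover have "of_bool (\<not> close_to_junta n k \<epsilon>\<^sub>1 (?f G)) = (1::real)" using False by simp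
      ultimately show ?thesis by linarith
    qed
    then have "(\<Sum>G\<in>Pow K. ?R (?f G)) \<le> (\<Sum>G\<in>Pow K. 1 / 3 + of_bool (\<not> close_to_junta n k \<epsilon>\<^sub>1 (?f G)))"
      by (intro sum_mono)
    also have "\<dots> = ?N / 3 + real (card {G \<in> Pow K. \<not> close_to_junta n k \<epsilon>\<^sub>1 (?f G)})"
      by (simp add: sum.distrib card_Pow of_bool_def sum.If_cases Int_def)
    also have "\<dots> \<le> ?N * (1 / 3 + 1 / 10)" using close[OF \<theta>] by simp
    finally show ?thesis .
  qed
  have Ew: "real E ^ w > 0" "real E ^ s > 0" "?N > 0" using pos by auto
  have "real (card \<Theta>) * (?N * (9 / 10) * (2 / 3)) \<le> real (card \<Theta>) * (\<Sum>G\<in>Pow K. ?R (\<lambda>x. key x \<in> G))"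
    by (intro mult_left_mono no) simp
  also have "\<dots> \<le> (\<Sum>\<theta>\<in>\<Theta>. \<Sum>G\<in>Pow K. ?R (\<lambda>x. canon \<theta> (key x) \<in> G)) + ?N * (real q)\<^sup>2 * real E ^ w / real E ^ s"
    by (rule sum_prob_reject_le[OF q])
  also have "\<dots> \<le> (\<Sum>\<theta>\<in>\<Theta>. ?N * (1 / 3 + 1 / 10)) + ?N * (real q)\<^sup>2 * real E ^ w / real E ^ s"
    by (intro add_right_mono sum_mono yes)
  finally have "real E ^ w * (?N * (9 / 10) * (2 / 3)) \<le>
      real E ^ w * (?N * (1 / 3 + 1 / 10)) + ?N * (real q)\<^sup>2 * real E ^ w / real E ^ s"
    by (simp add: card_Theta)
  then have "(real E ^ w * ?N) * (9 / 10 * (2 / 3)) \<le> (real E ^ w * ?N) * (13 / 30 + (real q)\<^sup>2 / real E ^ s)"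
    by (simp add: algebra_simps)
  then have "9 / 10 * (2 / 3) \<le> 13 / 30 + (real q)\<^sup>2 / real E ^ s"
    using Ew by (subst (asm) mult_le_cancel_left_pos) auto
  \<comment> \<open>The exact difference is \<open>3 / 5 - 13 / 30 = 1 / 6\<close>.\<close>
  then have "1 / 10 \<le> (real q)\<^sup>2 / real E ^ s" by simp
  then show ?thesis using Ew by (simp add: field_simps)
qed

end

section \<open>Realizing the selection and fixing the sizes\<close>

text \<open>Every one of the \<open>v ^ w\<close> selections is served by exactly \<open>L\<close>
  addresses, which makes the choices in the blocks independent and uniform. \<open>L\<close> remains
  free to tune the density of \<open>Act\<close>.\<close>

lemma uniform_selection_exists:
  fixes v w L p :: nat
  assumes v: "v > 0" and le: "L * v ^ w \<le> 2 ^ p"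
  shows "\<exists>Act b. Act \<subseteq> cube p \<and> card Act = L * v ^ w \<and> (\<forall>u j. b u j < v) \<and>
     (\<forall>\<phi> :: nat \<Rightarrow> nat \<Rightarrow> real. (\<Sum>u\<in>Act. \<Prod>j<w. \<phi> j (b u j)) =
        real (card Act) * (\<Prod>j<w. (\<Sum>i<v. \<phi> j i) / real v))"
proof -
  let ?P = "\<Pi>\<^sub>E j\<in>{..<w}. {..<v}"
  have "\<exists>Act. Act \<subseteq> cube p \<and> card Act = L * v ^ w"
  proof (rule obtain_subset_with_card_n[of "L * v ^ w" "cube p"])
    show "L * v ^ w \<le> card (cube p)" unfolding card_cube by (rule le)
  qed (intro exI conjI)
  then obtain Act where Act: "Act \<subseteq> cube p" "card Act = L * v ^ w" by (elim exE conjE)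
  have fin: "finite Act" using Act(1) finite_subset finite_cube by blast
  have "card Act = card ({..<L} \<times> ?P)"
    by (simp add: Act(2) card_cartesian_product card_PiE)
  moreover have "finite ({..<L} \<times> ?P)" by (simp add: finite_PiE)
  ultimately obtain h where h: "bij_betw h Act ({..<L} \<times> ?P)"
    using finite_same_card_bij[OF fin] by blast
  \<comment> \<open>The default 0 keeps \<open>b u j < v\<close> true for all arguments, as the
    locale demands.\<close>
  define b where "b u j = (if u \<in> Act \<and> j < w then snd (h u) j else 0)" for u j
  have hP: "snd (h u) \<in> ?P" if "u \<in> Act" for u
    using bij_betw_apply[OF h that] by (simp only: mem_Times_iff)
  have b_less: "b u j < v" for u j
  proof (cases "u \<in> Act \<and> j < w")
    case True
    then show ?thesis using PiE_mem[OF hP, of u j] by (simp add: b_def)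
  next
    case False
    then show ?thesis unfolding b_def using v by auto
  qed
  have "(\<Sum>u\<in>Act. \<Prod>j<w. \<phi> j (b u j)) = real (card Act) * (\<Prod>j<w. (\<Sum>i<v. \<phi> j i) / real v)"
    for \<phi> :: "nat \<Rightarrow> nat \<Rightarrow> real"
  proof -
    have "(\<Sum>u\<in>Act. \<Prod>j<w. \<phi> j (b u j)) = (\<Sum>u\<in>Act. \<Prod>j<w. \<phi> j (snd (h u) j))"
      by (intro sum.cong prod.cong refl) (auto simp: b_def)
    also have "\<dots> = (\<Sum>\<kappa>\<in>{..<L} \<times> ?P. \<Prod>j<w. \<phi> j (snd \<kappa> j))"
      using h by (rule sum.reindex_bij_betw)
    also have "\<dots> = (\<Sum>l<L. \<Sum>\<beta>\<in>?P. \<Prod>j<w. \<phi> j (\<beta> j))"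
      by (simp only: sum.cartesian_product case_prod_unfold)
    also have "\<dots> = real L * (\<Prod>j<w. \<Sum>i<v. \<phi> j i)"
      by (simp add: prod_sum_PiE)
    also have "\<dots> = real (card Act) * (\<Prod>j<w. (\<Sum>i<v. \<phi> j i) / real v)"
      using v by (simp add: Act(2) prod_dividef)
    finally show ?thesis .
  qed
  then show ?thesis using Act b_less by blast
qed

lemma code_family_exists:
  assumes "s \<ge> 1"
  shows "\<exists>C :: 'a set \<Rightarrow> 'a set set. \<forall>D. finite D \<longrightarrow> is_code s D (C D) \<and> (\<forall>x::real. 0 < x \<longrightarrow> x \<le> 1 \<longrightarrow>
           2 ^ card D * x ^ (s - 1) \<le> real (card (C D)) * (1 + x) ^ card D)"
proof -
  have "\<forall>D :: 'a set. \<exists>C. finite D \<longrightarrow> is_code s D C \<and> (\<forall>x::real. 0 < x \<longrightarrow> x \<le> 1 \<longrightarrow>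
           2 ^ card D * x ^ (s - 1) \<le> real (card C) * (1 + x) ^ card D)"
    using code_exists[OF _ assms] by blast
  then show ?thesis by (rule choice)
qed

lemma two_power_ge: "(2::nat) ^ (y + 4) \<ge> 2 * (y + 4) + 3"
  by (induction y) (auto simp: power_add)

lemma tester_queries_lower_bound:
  fixes k D E s r a q :: nat and x \<gamma> \<eta> \<epsilon>\<^sub>1 \<epsilon>\<^sub>2 :: real
  assumes tester: "is_junta_tester (real k) ((1 + \<gamma>) * real k) \<epsilon>\<^sub>1 \<epsilon>\<^sub>2 A"
    and q: "\<And>n t f. t \<in> set_pmf (A n) \<Longrightarrow> num_queries t f \<le> q"
    and D: "D \<ge> 2" and E: "E \<ge> 3" and s: "s \<ge> 1" and x: "0 < x" "x \<le> 1"
    and \<gamma>: "\<gamma> > 0" and k: "k \<ge> 1" "k \<le> 2 ^ a"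
    and size: "real r + real D * real E * real a + real D * (real E)\<^sup>2 + \<gamma> * real k \<le> real k / (2 * real E)"
    and \<eta>: "\<eta> = exp (- real D / 8)" "\<eta> < 1 / 2"
    and \<epsilon>\<^sub>2: "\<epsilon>\<^sub>2 > 0"
    and le_one: "\<epsilon>\<^sub>2 / (1 / 2 - \<eta>) + 1 / 2 ^ r \<le> 1"
    and le_hi: "(\<epsilon>\<^sub>2 / (1 / 2 - \<eta>) + 1 / 2 ^ r) * (1 / 2 - x ^ (s - 1) * (1 - x) ^ D / 2 + \<eta>) \<le> \<epsilon>\<^sub>1"
  shows "real E ^ s \<le> 10 * (real q)\<^sup>2"
proof -
  define e d where "e = real E" and "d = real D"
  have e: "e \<ge> 3" and d: "d \<ge> 2" using E D by (auto simp: e_def d_def)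
  \<comment> \<open>If \<open>u0\<close> were \<rho>, then \<open>(1 + \<gamma>) * k\<close> would
    be \<open>d * e * (e - 1 / 2) * u0\<close>, halfway between the
    \<open>d * e * (e - 1) * u0\<close> unhidden block variables and all
    \<open>d * e\<^sup>2 * u0\<close> of them. This leaves room below for the address, and forces
    far juntas to ignore half as many variables as are hidden.\<close>
  define \<rho> where "\<rho> = (1 + \<gamma>) * real k / (d * e * (e - 1 / 2))"
  define u0 where "u0 = nat \<lceil>\<rho>\<rceil>"
  have den: "d * e * (e - 1 / 2) > 0" using e d by simp
  have "(1 + \<gamma>) * real k > 0" using \<gamma> k by simp
  then have \<rho>: "\<rho> > 0" unfolding \<rho>_def using den by (rule divide_pos_pos)
  have u0: "\<rho> \<le> real u0" "real u0 \<le> \<rho> + 1" "u0 > 0"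
    using \<rho> unfolding u0_def by linarith+
  \<comment> \<open>Since \<open>v \<le> 2 ^ a\<close>, the summand \<open>w * a\<close> suffices to
    encode a selection; the \<open>r\<close> further bits let the density be tuned in steps of at
    most \<open>1 / 2 ^ r\<close>.\<close>
  define v w p where "v = E * u0" and "w = D * E" and "p = r + w * a"
  have v: "v > 0" and w: "w > 0" using u0 E D by (auto simp: v_def w_def)
  have "u0 \<le> v" using E by (simp add: v_def)
  have wvu: "real (w * (v - u0)) = d * e * (e - 1) * real u0"
    using \<open>u0 \<le> v\<close> by (simp add: of_nat_diff v_def w_def d_def e_def algebra_simps)
  have "d * e * (e - 1) * real u0 \<le> d * e * (e - 1) * (\<rho> + 1)"
    using u0 e d by (intro mult_left_mono) auto
  also have "\<dots> = (1 + \<gamma>) * real k * ((e - 1) / (e - 1 / 2)) + d * e * (e - 1)"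
    using e d unfolding \<rho>_def by (simp add: field_simps)
  also have "\<dots> \<le> (1 + \<gamma>) * real k * (1 - 1 / (2 * e)) + d * e\<^sup>2"
  proof (intro add_mono mult_left_mono)
    show "(e - 1) / (e - 1 / 2) \<le> 1 - 1 / (2 * e)" using e by (simp add: field_simps)
    show "d * e * (e - 1) \<le> d * e\<^sup>2" using e d by (simp add: power2_eq_square)
  qed (use \<gamma> in auto)
  also have "\<dots> = real k + \<gamma> * real k - real k / (2 * e) - \<gamma> * real k / (2 * e) + d * e\<^sup>2"
    by (simp add: algebra_simps add_divide_distrib)
  also have "\<dots> \<le> real k - real r - d * e * real a"
  proof -
    have "\<gamma> * real k / (2 * e) \<ge> 0" using \<gamma> e by simp
    then show ?thesis using size unfolding e_def[symmetric] d_def[symmetric] by linarith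
  qed
  finally have k_bound: "real (p + w * (v - u0)) \<le> real k"
    unfolding of_nat_add wvu by (simp add: p_def w_def d_def e_def)
  have "v \<le> w * (v - u0)"
  proof -
    have "real v = 1 * e * real u0" by (simp add: v_def e_def)
    also have "\<dots> \<le> d * (e - 1) * e * real u0"
    proof (intro mult_right_mono)
      have "2 * 2 \<le> d * (e - 1)" using d e by (intro mult_mono) auto
      then show "1 \<le> d * (e - 1)" by simp
    qed (use e in auto)
    also have "\<dots> = real (w * (v - u0))" unfolding wvu by (simp only: mult_ac)
    finally show ?thesis by (simp only: of_nat_le_iff)
  qed
  also have "\<dots> \<le> k" using k_bound unfolding of_nat_le_iff by simp
  finally have va: "v \<le> 2 ^ a" using k(2) by simp
  define g where "g = real v ^ w / 2 ^ p"
  have g: "g > 0" using v by (simp add: g_def)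
  have gr: "g \<le> 1 / 2 ^ r"
  proof -
    have "real v \<le> 2 ^ a" using of_nat_mono[OF va, where 'a = real] by simp
    then have "real v ^ w \<le> (2 ^ a) ^ w" by (intro power_mono) auto
    also have "\<dots> = 2 ^ (w * a)" by (simp add: power_mult mult.commute flip: power_mult)
    finally show ?thesis by (simp add: g_def p_def power_add field_simps)
  qed
  \<comment> \<open>The density at which the far distance is exactly
    \<open>\<epsilon>\<^sub>2\<close>; \<open>L\<close> rounds it up to a multiple of
    \<open>g\<close>, the density of one copy of all selections.\<close>
  define lo where "lo = \<epsilon>\<^sub>2 / (1 / 2 - \<eta>)"
  have lo: "lo > 0" using \<epsilon>\<^sub>2 \<eta>(2) by (simp add: lo_def)
  define L where "L = nat \<lceil>lo / g\<rceil>"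
  have "lo / g > 0" using lo g by simp
  then have L: "lo / g \<le> real L" "real L \<le> lo / g + 1" "L > 0"
    unfolding L_def by linarith+
  have Lg: "lo \<le> real L * g" "real L * g \<le> lo + 1 / 2 ^ r"
  proof -
    show "lo \<le> real L * g" using L(1) g by (simp add: field_simps)
    have "real L * g \<le> (lo / g + 1) * g" using L(2) g by (intro mult_right_mono) auto
    also have "\<dots> = lo + g" using g by (simp add: field_simps)
    finally show "real L * g \<le> lo + 1 / 2 ^ r" using gr by linarith
  qed
  have "real L * g \<le> 1" using Lg(2) le_one by (simp add: lo_def)
  then have "real (L * v ^ w) \<le> real (2 ^ p)" by (simp add: g_def field_simps)
  then have "L * v ^ w \<le> 2 ^ p" by (simp only: of_nat_le_iff)
  from uniform_selection_exists[OF v this]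
  obtain Act b where Act: "Act \<subseteq> cube p" and cardAct: "card Act = L * v ^ w"
    and b: "\<forall>u j. b u j < v" and unif: "\<forall>\<phi> :: nat \<Rightarrow> nat \<Rightarrow> real. (\<Sum>u\<in>Act. \<Prod>j<w. \<phi> j (b u j)) =
        real (card Act) * (\<Prod>j<w. (\<Sum>i<v. \<phi> j i) / real v)"
    by (elim exE conjE)
  obtain C :: "nat set \<Rightarrow> nat set set" where C: "\<forall>D. finite D \<longrightarrow> is_code s D (C D) \<and> (\<forall>x::real. 0 < x \<longrightarrow> x \<le> 1 \<longrightarrow>
           2 ^ card D * x ^ (s - 1) \<le> real (card (C D)) * (1 + x) ^ card D)"
    using code_family_exists[OF s] by blast
  interpret H: hidden_blocks p w E u0 s Act b C
  proof
    show "Act \<noteq> {}" using cardAct L(3) v by auto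
    show "b u j < E * u0" for u j using b by (simp add: v_def)
    show "(\<Sum>u\<in>Act. \<Prod>j<w. \<phi> j (b u j)) =
        real (card Act) * (\<Prod>j<w. (\<Sum>i<E * u0. \<phi> j i) / real (E * u0))" for \<phi> :: "nat \<Rightarrow> nat \<Rightarrow> real"
      using unif unfolding v_def by blast
  qed (use Act E u0 s C in auto)
  have Hv: "H.v = v" by (simp add: H.v_def v_def)
  have dens: "H.dens = real L * g" by (simp add: H.dens_def cardAct g_def)
  define m\<^sub>0 where "m\<^sub>0 = d * e * real u0 / 2"
  have wv: "real (w * v) = d * e\<^sup>2 * real u0" by (simp add: w_def v_def d_def e_def power2_eq_square)
  have m0_exp: "- m\<^sub>0 / (2 * real v) = - (d / 4)"
    using u0 e by (simp add: m\<^sub>0_def v_def e_def field_simps)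
  show ?thesis
  proof (rule H.queries_lower_bound[OF tester q x])
    show "0 \<le> \<eta>" by (simp add: \<eta>(1))
    show "real (p + w * (H.v - u0)) \<le> real k" using k_bound by (simp add: Hv)
    show "m\<^sub>0 \<le> real (w * H.v) - (1 + \<gamma>) * real k"
    proof -
      have "(1 + \<gamma>) * real k = \<rho> * (d * e * (e - 1 / 2))" using den e d by (simp add: \<rho>_def)
      also have "\<dots> \<le> real u0 * (d * e * (e - 1 / 2))" using den u0 by (intro mult_right_mono) auto
      also have "\<dots> = real (w * v) - m\<^sub>0" unfolding wv m\<^sub>0_def by (simp add: algebra_simps power2_eq_square)
      finally show ?thesis by (simp add: Hv)
    qed
    show "\<epsilon>\<^sub>2 \<le> H.dens * (1 / 2 - \<eta>)"
    proof -
      have "\<epsilon>\<^sub>2 = lo * (1 / 2 - \<eta>)" using \<eta>(2) by (simp add: lo_def)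
      also have "\<dots> \<le> H.dens * (1 / 2 - \<eta>)" unfolding dens using Lg \<eta>(2) by (intro mult_right_mono) auto
      finally show ?thesis .
    qed
    show "H.dens * (1 / 2 - x ^ (s - 1) * (1 - x / real E) ^ w / 2 + \<eta>) \<le> \<epsilon>\<^sub>1"
    proof -
      \<comment> \<open>Bernoulli's inequality removes \<open>E\<close> from the code density,
        leaving a bound in \<open>D\<close> alone.\<close>
      have "1 + real E * (- (x / real E)) \<le> (1 + - (x / real E)) ^ E"
        using x e by (intro Bernoulli_inequality) (auto simp: e_def field_simps)
      then have "1 - x \<le> (1 - x / real E) ^ E" using e by (simp add: e_def)
      then have "(1 - x) ^ D \<le> ((1 - x / real E) ^ E) ^ D" using x by (intro power_mono) auto
      also have "\<dots> = (1 - x / real E) ^ w" by (simp add: w_def mult.commute flip: power_mult)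
      finally have "x ^ (s - 1) * (1 - x) ^ D \<le> x ^ (s - 1) * (1 - x / real E) ^ w"
        using x by (intro mult_left_mono) auto
      then have "H.dens * (1 / 2 - x ^ (s - 1) * (1 - x / real E) ^ w / 2 + \<eta>) \<le>
          H.dens * (1 / 2 - x ^ (s - 1) * (1 - x) ^ D / 2 + \<eta>)"
        unfolding dens using g by (intro mult_left_mono) auto
      also have "\<dots> \<le> (lo + 1 / 2 ^ r) * (1 / 2 - x ^ (s - 1) * (1 - x) ^ D / 2 + \<eta>)"
      proof (rule mult_right_mono)
        have "x ^ (s - 1) * (1 - x) ^ D \<le> 1 * 1"
          using x by (intro mult_mono power_le_one) auto
        then show "0 \<le> 1 / 2 - x ^ (s - 1) * (1 - x) ^ D / 2 + \<eta>" using \<eta>(1) exp_ge_zero[of "- real D / 8"] by linarith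
      qed (use Lg(2) dens in simp)
      also have "\<dots> \<le> \<epsilon>\<^sub>1" using le_hi by (simp add: lo_def)
      finally show ?thesis .
    qed
    show "real (w * H.v) + real (card H.K) * exp (- m\<^sub>0 / (2 * real H.v)) + 3 \<le> 2 * \<eta>\<^sup>2 * real (card H.K)"
    proof -
      \<comment> \<open>\<eta> is chosen so that \<open>\<eta>\<^sup>2\<close> equals
        \<open>exp (- m\<^sub>0 / (2 * v))\<close>. The invariant sets thus use up half of the right
        side, and the other half, at least \<open>card K / 2 ^ D\<close>, has to cover
        \<open>w * v + 3\<close>.\<close>
      have \<eta>2: "\<eta>\<^sup>2 = exp (- (d / 4))"
        unfolding \<eta>(1) d_def by (simp add: power2_eq_square flip: exp_add)
      have "exp (d / 4) \<le> 2 ^ D"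
      proof -
        have "exp (1 / 4 :: real) \<le> 2"
          using exp_bound[of "1 / 4"] by (simp add: power2_eq_square)
        then have "exp (1 / 4 :: real) ^ D \<le> 2 ^ D" by (intro power_mono) auto
        then show ?thesis by (simp add: d_def flip: exp_of_nat_mult)
      qed
      then have inv: "1 / 2 ^ D \<le> exp (- (d / 4))" by (simp add: exp_minus field_simps)
      have "D * 2 \<le> D * (E - 1)" using E by (intro mult_left_mono) auto
      then have y: "w \<le> 2 * (w - D)" "w - D \<ge> 4" "D \<le> w"
        using D E by (auto simp: w_def algebra_simps diff_mult_distrib2)
      have "w + 3 \<le> 2 * (w - D) + 3" using y by simp
      also have "\<dots> \<le> 2 ^ (w - D)" using two_power_ge[of "w - D - 4"] y by simp
      finally have "real (w + 3) \<le> real (2 ^ (w - D))" by (rule of_nat_mono)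
      then have w3: "real w + 3 \<le> 2 ^ (w - D)" by simp
      have "real (w * v) + 3 \<le> real v * (real w + 3)" using v by (simp add: algebra_simps)
      also have "\<dots> \<le> real v * 2 ^ (w - D)" using w3 by (intro mult_left_mono) auto
      also have "\<dots> \<le> real v ^ w * 2 ^ (w - D)"
        using v w by (intro mult_right_mono self_le_power) auto
      also have "\<dots> \<le> real L * real v ^ w * 2 ^ (w - D)"
      proof (rule mult_right_mono)
        have "1 * real v ^ w \<le> real L * real v ^ w" using L(3) by (intro mult_right_mono) auto
        then show "real v ^ w \<le> real L * real v ^ w" by simp
      qed simp
      also have "\<dots> = real (card H.K) * (1 / 2 ^ D)"
      proof -
        have "(2::real) ^ w = 2 ^ (w - D) * 2 ^ D" using y(3) by (simp flip: power_add)
        then show ?thesis by (simp add: H.card_K cardAct)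
      qed
      also have "\<dots> \<le> real (card H.K) * exp (- (d / 4))"
        using inv by (intro mult_left_mono) auto
      finally show ?thesis unfolding Hv m0_exp \<eta>2
        by (simp add: algebra_simps)
    qed
  qed
qed

section \<open>Choice of parameters\<close>

text \<open>Here \<open>y ^ 10\<close> is \<open>k\<close>. After multiplication by
  \<open>e\<close>, the bounds \<open>e\<^sup>2 \<le> y ^ 5\<close> and \<open>e \<le> y ^ 3\<close>
  make every term but the last \<open>O(y ^ 9)\<close>, and \<open>\<gamma> * e ^ 4 \<le> 1\<close>
  controls the last.\<close>

lemma size_bound:
  fixes y e \<gamma> D r a :: real
  assumes y: "y \<ge> 1024" and e: "e \<ge> 3" "e ^ 4 \<le> y ^ 10" and \<gamma>: "\<gamma> * e ^ 4 \<le> 1"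
    and D: "0 \<le> D" "D \<le> 20 * y" and r: "r \<le> 2 * y" and a: "0 \<le> a" "a \<le> 21 * y"
  shows "r + D * e * a + D * e\<^sup>2 + \<gamma> * y ^ 10 \<le> y ^ 10 / (2 * e)"
proof -
  have "(e\<^sup>2)\<^sup>2 \<le> (y ^ 5)\<^sup>2" using e by (simp flip: power_mult)
  then have e2: "e\<^sup>2 \<le> y ^ 5" by (rule power2_le_imp_le) (use y in simp)
  also have "y ^ 5 \<le> y ^ 6" using y by (intro power_increasing) auto
  finally have "e\<^sup>2 \<le> (y ^ 3)\<^sup>2" by (simp flip: power_mult)
  then have e1: "e \<le> y ^ 3" by (rule power2_le_imp_le) (use y in simp)
  have mono: "y ^ i \<le> y ^ 9" if "i \<le> 9" for i using y that by (intro power_increasing) auto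
  have "r * e \<le> 2 * y * y ^ 3" using r e1 e y by (intro mult_mono) auto
  also have "\<dots> = 2 * y ^ 4" by (simp add: eval_nat_numeral)
  finally have 1: "r * e \<le> 2 * y ^ 9" using mono[of 4] by simp
  have "D * a * e\<^sup>2 \<le> (20 * y) * (21 * y) * y ^ 5" using D a e2 y by (intro mult_mono) auto
  also have "\<dots> = 420 * y ^ 7" by (simp add: eval_nat_numeral)
  finally have 2: "D * a * e\<^sup>2 \<le> 420 * y ^ 9" using mono[of 7] by simp
  have "D * (e\<^sup>2 * e) \<le> (20 * y) * (y ^ 5 * y ^ 3)" using D e1 e2 e y by (intro mult_mono) auto
  also have "\<dots> = 20 * y ^ 9" by (simp add: eval_nat_numeral)
  finally have 3: "D * (e\<^sup>2 * e) \<le> 20 * y ^ 9" .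
  have 4: "\<gamma> * e \<le> 1 / 27"
  proof -
    have "27 \<le> e ^ 3" using power_mono[OF e(1), of 3] by simp
    show ?thesis
    proof (cases "\<gamma> \<le> 0")
      case True
      then show ?thesis using e mult_nonpos_nonneg[of \<gamma> e] by linarith
    next
      case False
      then have "(\<gamma> * e) * 27 \<le> (\<gamma> * e) * e ^ 3" using e \<open>27 \<le> e ^ 3\<close> by (intro mult_left_mono) auto
      also have "\<dots> = \<gamma> * e ^ 4" by (simp add: eval_nat_numeral)
      finally show ?thesis using \<gamma> by simp
    qed
  qed
  have "(\<gamma> * e) * y ^ 10 \<le> 1 / 27 * y ^ 10" using 4 y by (intro mult_right_mono) auto
  moreover have "1024 * y ^ 9 \<le> y ^ 10"
    using mult_right_mono[OF y, of "y ^ 9"] y by (simp add: eval_nat_numeral)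
  \<comment> \<open>The coefficients of \<open>y ^ 9\<close> add up to 442, below
    \<open>1024 * (1 / 2 - 1 / 27)\<close>.\<close>
  ultimately have "r * e + D * a * e\<^sup>2 + D * (e\<^sup>2 * e) + (\<gamma> * e) * y ^ 10 \<le> y ^ 10 / 2"
    using 1 2 3 zero_le_power[of y 10] y by linarith
  then have "(r + D * e * a + D * e\<^sup>2 + \<gamma> * y ^ 10) * e \<le> y ^ 10 / 2"
    by (simp add: algebra_simps power2_eq_square)
  then show ?thesis using e by (simp add: field_simps)
qed

lemma exp_neg_le: "exp (- real i) \<le> (1 / 2) ^ i"
proof -
  have "exp (-1 :: real) \<le> 1 / 2"
    using exp_ge_add_one_self[of 1] by (simp add: exp_minus field_simps)
  then have "exp (-1 :: real) ^ i \<le> (1 / 2) ^ i" by (intro power_mono) auto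
  then show ?thesis by (simp flip: exp_of_nat_mult)
qed

text \<open>The choice is \<open>s = m + 1\<close>, \<open>x = 1 / 100\<close>,
  \<open>D = 200 * m\<close>: the code density is at least \<open>T = 2 powr (- 10 * m)\<close>
  because \<open>1 / 100 * (99 / 100) ^ 200 \<ge> 1 / 1024\<close>, whereas
  \<open>\<eta> = exp (- 25 * m)\<close> is smaller than \<open>T\<close> by a factor of at least
  32768.\<close>

lemma small_gap_parameters:
  fixes \<epsilon>\<^sub>1 \<epsilon>\<^sub>2 \<eta> T :: real and m :: nat
  assumes m: "m \<ge> 1" and T: "T = (1 / 1024) ^ m"
    and \<epsilon>: "1 / 100 \<le> \<epsilon>\<^sub>1" "\<epsilon>\<^sub>2 \<le> 49 / 100" "\<epsilon>\<^sub>2 - \<epsilon>\<^sub>1 \<le> T / 256" "\<epsilon>\<^sub>1 < \<epsilon>\<^sub>2"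
    and \<eta>: "\<eta> = exp (- real (200 * m) / 8)"
  shows "\<eta> < 1 / 2" "\<epsilon>\<^sub>2 / (1 / 2 - \<eta>) + 1 / 2 ^ (10 * m + 7) \<le> 1"
    "(\<epsilon>\<^sub>2 / (1 / 2 - \<eta>) + 1 / 2 ^ (10 * m + 7)) *
       (1 / 2 - (1 / 100) ^ (m + 1 - 1) * (1 - 1 / 100) ^ (200 * m) / 2 + \<eta>) \<le> \<epsilon>\<^sub>1"
proof -
  have T0: "0 < T" "T \<le> 1 / 1024"
    using m power_decreasing[of 1 m "1 / 1024 :: real"] by (auto simp: T)
  have "\<eta> = exp (- real (25 * m))" by (simp add: \<eta>)
  also have "\<dots> \<le> (1 / 2) ^ (25 * m)" by (rule exp_neg_le)
  also have "\<dots> = T * (1 / 32768) ^ m"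
  proof -
    have "(1 / 2 :: real) ^ 25 = 1 / 1024 * (1 / 32768)" by (simp add: power_one_over)
    then show ?thesis unfolding T power_mult by (simp only: power_mult_distrib)
  qed
  also have "\<dots> \<le> T * (1 / 32768)"
    using m power_decreasing[of 1 m "1 / 32768 :: real"] T0 by (intro mult_left_mono) auto
  finally have \<eta>T: "\<eta> \<le> T / 32768" by simp
  have \<eta>0: "\<eta> > 0" by (simp add: \<eta>)
  show \<eta>half: "\<eta> < 1 / 2" using \<eta>T T0 by linarith
  have rT: "1 / 2 ^ (10 * m + 7) = T / 128"
    by (simp add: T power_add power_mult power_one_over)
  let ?h = "1 / 2 - \<eta>"
  have h: "?h > 499 / 1000" using \<eta>T T0 by linarith
  \<comment> \<open>This is the density of the active addresses before rounding, so the bound 0.49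
    on \<open>\<epsilon>\<^sub>2\<close> keeps it below 1.\<close>
  have "\<epsilon>\<^sub>2 / ?h \<le> (49 / 100) / (499 / 1000)"
    using \<epsilon> h by (intro frac_le) auto
  then show "\<epsilon>\<^sub>2 / ?h + 1 / 2 ^ (10 * m + 7) \<le> 1" unfolding rT using T0 by simp
  have "T \<le> (1 / 100 * (1 - 1 / 100) ^ 200) ^ m"
  proof -
    have "1 + real 10 * (- (1 / 100)) \<le> (1 + - (1 / 100 :: real)) ^ 10"
      by (rule Bernoulli_inequality) simp
    then have "9 / 10 \<le> (1 - 1 / 100 :: real) ^ 10" by simp
    then have "(9 / 10) ^ 20 \<le> ((1 - 1 / 100 :: real) ^ 10) ^ 20" by (rule power_mono) simp
    also have "\<dots> = (1 - 1 / 100) ^ 200" by (subst power_mult[symmetric]) simp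
    finally have "1 / 100 * (9 / 10) ^ 20 \<le> 1 / 100 * (1 - 1 / 100 :: real) ^ 200"
      by (rule mult_left_mono) simp
    moreover have "1 / 1024 \<le> 1 / 100 * (9 / 10 :: real) ^ 20"
      by (simp add: power_divide)
    ultimately have "1 / 1024 \<le> 1 / 100 * (1 - 1 / 100 :: real) ^ 200" by linarith
    then show ?thesis unfolding T by (rule power_mono) simp
  qed
  also have "\<dots> = (1 / 100) ^ (m + 1 - 1) * (1 - 1 / 100) ^ (200 * m)"
    by (simp only: power_mult_distrib power_mult add_diff_cancel_right')
  finally have A: "T \<le> (1 / 100) ^ (m + 1 - 1) * (1 - 1 / 100) ^ (200 * m)" .
  let ?c = "1 / 2 - T / 2 + \<eta>"
  have c: "0 \<le> ?c" "?c \<le> 1 / 2" using \<eta>T T0 \<eta>0 by linarith+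
  have pre: "0 \<le> \<epsilon>\<^sub>2 / ?h + T / 128" using \<epsilon> h T0 by simp
  have "(\<epsilon>\<^sub>2 / ?h + T / 128) * (1 / 2 - (1 / 100) ^ (m + 1 - 1) * (1 - 1 / 100) ^ (200 * m) / 2 + \<eta>) \<le>
      (\<epsilon>\<^sub>2 / ?h + T / 128) * ?c"
    using A by (intro mult_left_mono pre) auto
  also have "\<dots> \<le> \<epsilon>\<^sub>1"
  proof -
    \<comment> \<open>The distance gap and the rounding of the density cost at most
      \<open>T / 512\<close> each. The advantage gains at least \<open>49 / 10000 * T\<close>, more
      than \<open>T / 256\<close>; this rests on
      \<open>\<epsilon>\<^sub>1 \<ge> 1 / 100\<close>.\<close>
    have "(\<epsilon>\<^sub>2 - \<epsilon>\<^sub>1) * ?c \<le> T / 256 * (1 / 2)" using \<epsilon> c T0 by (intro mult_mono) auto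
    moreover have "T / 128 * ?c * ?h \<le> T / 128 * (1 / 2) * (1 / 2)"
      using c h T0 \<eta>0 by (intro mult_mono mult_nonneg_nonneg) auto
    moreover have "\<epsilon>\<^sub>1 * (?h - ?c) \<ge> 1 / 100 * (49 / 100 * T)"
      using \<epsilon> \<eta>T T0 by (intro mult_mono) auto
    ultimately have "\<epsilon>\<^sub>1 * (?h - ?c) \<ge> (\<epsilon>\<^sub>2 - \<epsilon>\<^sub>1) * ?c + T / 128 * ?c * ?h" using T0 by linarith
    then have "\<epsilon>\<^sub>2 * ?c + T / 128 * ?c * ?h \<le> \<epsilon>\<^sub>1 * ?h"
    proof -
      have "\<epsilon>\<^sub>2 * c + t * c * h \<le> \<epsilon>\<^sub>1 * h" if "(\<epsilon>\<^sub>2 - \<epsilon>\<^sub>1) * c + t * c * h \<le> \<epsilon>\<^sub>1 * (h - c)" for c h t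
        using that by (simp add: algebra_simps)
      then show ?thesis using \<open>\<epsilon>\<^sub>1 * (?h - ?c) \<ge> (\<epsilon>\<^sub>2 - \<epsilon>\<^sub>1) * ?c + T / 128 * ?c * ?h\<close> .
    qed
    moreover have "(\<epsilon>\<^sub>2 / ?h + T / 128) * ?c * ?h = \<epsilon>\<^sub>2 * ?c + T / 128 * ?c * ?h"
      using h by (simp add: distrib_right)
    ultimately have "(\<epsilon>\<^sub>2 / ?h + T / 128) * ?c * ?h \<le> \<epsilon>\<^sub>1 * ?h" by linarith
    then show ?thesis using h by (subst (asm) mult_le_cancel_right_pos) auto
  qed
  finally show "(\<epsilon>\<^sub>2 / ?h + 1 / 2 ^ (10 * m + 7)) *
       (1 / 2 - (1 / 100) ^ (m + 1 - 1) * (1 - 1 / 100) ^ (200 * m) / 2 + \<eta>) \<le> \<epsilon>\<^sub>1" unfolding rT .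
qed

text \<open>With \<open>s = 1\<close> the factor \<open>x ^ (s - 1)\<close> is 1 and
  \<open>x\<close> may be tiny: the close functions are almost juntas, at distance below 0.01
  whatever the gap is. The resulting bound in a single power of \<open>E\<close> suffices when
  \<open>- log 2 (\<epsilon>\<^sub>2 - \<epsilon>\<^sub>1)\<close> is bounded.\<close>

lemma large_gap_parameters:
  fixes \<epsilon>\<^sub>1 \<epsilon>\<^sub>2 \<eta> :: real
  assumes \<epsilon>: "1 / 100 \<le> \<epsilon>\<^sub>1" "\<epsilon>\<^sub>2 \<le> 49 / 100" "0 < \<epsilon>\<^sub>2"
    and \<eta>: "\<eta> = exp (- real 80 / 8)"
  shows "\<eta> < 1 / 2" "\<epsilon>\<^sub>2 / (1 / 2 - \<eta>) + 1 / 2 ^ 7 \<le> 1"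
    "(\<epsilon>\<^sub>2 / (1 / 2 - \<eta>) + 1 / 2 ^ 7) *
       (1 / 2 - (1 / 100000) ^ (1 - 1) * (1 - 1 / 100000) ^ 80 / 2 + \<eta>) \<le> \<epsilon>\<^sub>1"
proof -
  have "\<eta> = exp (- real 10)" by (simp add: \<eta>)
  also have "\<dots> \<le> (1 / 2) ^ 10" by (rule exp_neg_le)
  finally have \<eta>s: "\<eta> \<le> 1 / 1024" by (simp add: power_one_over)
  have \<eta>0: "\<eta> > 0" by (simp add: \<eta>)
  show "\<eta> < 1 / 2" using \<eta>s by simp
  let ?h = "1 / 2 - \<eta>"
  have h: "?h \<ge> 511 / 1024" using \<eta>s by simp
  have "\<epsilon>\<^sub>2 / ?h \<le> (49 / 100) / (511 / 1024)"
    using \<epsilon> h by (intro frac_le) auto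
  then show one: "\<epsilon>\<^sub>2 / ?h + 1 / 2 ^ 7 \<le> 1" by simp
  have "1 + real 80 * (- (1 / 100000)) \<le> (1 + - (1 / 100000 :: real)) ^ 80"
    by (rule Bernoulli_inequality) simp
  then have B: "1 - 80 / 100000 \<le> (1 - 1 / 100000 :: real) ^ 80" by simp
  have B1: "(1 - 1 / 100000 :: real) ^ 80 \<le> 1" by (rule power_le_one) auto
  have "(\<epsilon>\<^sub>2 / ?h + 1 / 2 ^ 7) * (1 / 2 - (1 / 100000) ^ (1 - 1) * (1 - 1 / 100000) ^ 80 / 2 + \<eta>) \<le>
      1 * (1 / 100)"
    using one B \<eta>s B1 \<eta>0 by (intro mult_mono) (auto simp del: power_one_right)
  then show "(\<epsilon>\<^sub>2 / ?h + 1 / 2 ^ 7) *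
       (1 / 2 - (1 / 100000) ^ (1 - 1) * (1 - 1 / 100000) ^ 80 / 2 + \<eta>) \<le> \<epsilon>\<^sub>1" using \<epsilon>(1) by linarith
qed

lemma num_queries_le_query_complexity:
  assumes "t \<in> set_pmf (A n)"
  shows "enat (num_queries t f) \<le> query_complexity A"
  unfolding query_complexity_def
  by (rule SUP_upper2[of n], simp, rule SUP_upper2[of f], simp, rule SUP_upper[OF assms])

lemma power_lower_bound_from_tester:
  fixes k q :: nat and \<epsilon>\<^sub>1 \<epsilon>\<^sub>2 \<gamma> :: real
  assumes k: "k \<ge> 1" and \<epsilon>: "1 / 100 \<le> \<epsilon>\<^sub>1" "\<epsilon>\<^sub>1 < \<epsilon>\<^sub>2" "\<epsilon>\<^sub>2 \<le> 49 / 100"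
    and gap: "2 powr (- (real k powr (1 / 10))) \<le> \<epsilon>\<^sub>2 - \<epsilon>\<^sub>1"
    and \<gamma>: "1 / real k \<le> \<gamma>" "\<gamma> \<le> 1 / 2 ^ 100"
    and tester: "is_junta_tester (real k) ((1 + \<gamma>) * real k) \<epsilon>\<^sub>1 \<epsilon>\<^sub>2 A"
    and q: "\<And>n t f. t \<in> set_pmf (A n) \<Longrightarrow> num_queries t f \<le> q"
  shows "(1 / \<gamma>) powr (1 / 576 * (- log 2 (\<epsilon>\<^sub>2 - \<epsilon>\<^sub>1))) \<le> real q"
proof -
  \<comment> \<open>\<open>E\<close> will be \<open>B ^ 8\<close> rounded down, about
    \<open>(1 / \<gamma>) powr (1 / 4)\<close>. The lower bound used is the generous
    \<open>B ^ 4\<close>, which absorbs the rounding.\<close>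
  define l y B where "l = - log 2 (\<epsilon>\<^sub>2 - \<epsilon>\<^sub>1)" and "y = real k powr (1 / 10)" and "B = (1 / \<gamma>) powr (1 / 32)"
  have "1 / real k > 0" using k by simp
  then have \<gamma>0: "\<gamma> > 0" using \<gamma>(1) by linarith
  \<comment> \<open>The constant \<open>2 ^ 100\<close> serves two roots:
    \<open>y ^ 10 \<ge> 2 ^ 100\<close> gives \<open>y \<ge> 1024\<close>, and
    \<open>B ^ 32 \<ge> 2 ^ 100\<close> gives \<open>B \<ge> 8\<close>.\<close>
  have \<gamma>inv: "2 ^ 100 \<le> 1 / \<gamma>" using \<gamma>(2) \<gamma>0 by (simp add: field_simps)
  have k\<gamma>: "1 / \<gamma> \<le> real k" using \<gamma>(1) \<gamma>0 k by (simp add: field_simps)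
  have y10: "y ^ 10 = real k" using k by (simp add: y_def powr_powr flip: powr_realpow)
  have y: "y \<ge> 1024"
  proof (rule ccontr)
    assume "\<not> ?thesis"
    then have "y ^ 10 < 1024 ^ 10" by (intro power_strict_mono) (auto simp: y_def)
    moreover have "(2::real) ^ 100 = 1024 ^ 10" by simp
    ultimately show False using y10 k\<gamma> \<gamma>inv by linarith
  qed
  have B32: "B ^ 32 = 1 / \<gamma>" using \<gamma>0 by (simp add: B_def powr_powr flip: powr_realpow)
  have B: "B \<ge> 8"
  proof (rule ccontr)
    assume "\<not> ?thesis"
    then have "B ^ 32 < 8 ^ 32" by (intro power_strict_mono) (auto simp: B_def)
    moreover have "(8::real) ^ 32 \<le> 2 ^ 100" by simp
    ultimately show False using B32 \<gamma>inv by linarith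
  qed
  define E where "E = nat \<lfloor>B ^ 8\<rfloor>"
  have B8: "B ^ 8 = B ^ 4 * B ^ 4" by (simp flip: power_add)
  have "8 ^ 4 \<le> B ^ 4" using B by (intro power_mono) auto
  then have B4: "4096 \<le> B ^ 4" by simp
  have "2 * B ^ 4 \<le> B ^ 4 * B ^ 4" using B4 by (intro mult_right_mono) auto
  then have Ege: "B ^ 4 \<le> real E" and Ele: "real E \<le> B ^ 8"
    using B4 B8 unfolding E_def by linarith+
  have E3: "E \<ge> 3" using Ege B4 by linarith
  have "real E ^ 4 \<le> (B ^ 8) ^ 4" using Ele by (intro power_mono) auto
  also have "\<dots> = 1 / \<gamma>" by (simp flip: power_mult add: B32)
  finally have E4: "real E ^ 4 \<le> 1 / \<gamma>" .
  have E4y: "real E ^ 4 \<le> y ^ 10" using E4 k\<gamma> y10 by linarith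
  have \<gamma>E: "\<gamma> * real E ^ 4 \<le> 1" using E4 \<gamma>0 by (simp add: field_simps)
  define a where "a = nat \<lceil>log 2 (real k)\<rceil>"
  have logk: "log 2 (real k) \<ge> 0" using k by simp
  have "real k = 2 powr log 2 (real k)" using k by simp
  also have "\<dots> \<le> 2 powr real a" using logk unfolding a_def by (intro powr_mono) linarith+
  also have "\<dots> = real (2 ^ a)" by (simp add: powr_realpow)
  finally have ka: "k \<le> 2 ^ a" by (simp only: of_nat_le_iff)
  have ay: "real a \<le> 21 * y"
  proof -
    have "ln y \<le> y - 1" using y by (intro ln_le_minus_one) auto
    moreover have "ln (2::real) \<ge> 1 / 2" using ln2_ge_two_thirds by linarith
    ultimately have "ln y * 1 \<le> y * (2 * ln 2)" using y by (intro mult_mono) auto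
    then have "log 2 y \<le> 2 * y" by (simp add: log_def field_simps)
    moreover have "log 2 (real k) = 10 * log 2 y"
      using y by (simp add: log_nat_power flip: y10)
    ultimately have "log 2 (real k) \<le> 20 * y" by simp
    then show ?thesis using logk y unfolding a_def by linarith
  qed
  have \<delta>: "\<epsilon>\<^sub>2 - \<epsilon>\<^sub>1 = 2 powr (- l)" using \<epsilon> by (simp add: l_def)
  \<comment> \<open>The lower bound on the gap enters here: \<open>D\<close> and \<open>r\<close>
    grow linearly with \<open>l\<close>, and \<open>l \<le> y\<close> keeps the construction within
    \<open>k\<close> variables.\<close>
  have ly: "l \<le> y" using gap unfolding \<delta> y_def[symmetric] by simp
  have main: "\<exists>s\<ge>1. l \<le> 18 * real s \<and> real E ^ s \<le> 10 * (real q)\<^sup>2"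
  proof (cases "l \<ge> 18")
    case True
    \<comment> \<open>The largest \<open>m\<close> with \<open>10 * m + 8 \<le> l\<close>, that is,
      with a gap of at most \<open>T / 256\<close>. Maximality gives \<open>l < 10 * m + 18\<close>,
      hence the factor 18.\<close>
    define m where "m = nat \<lfloor>(l - 8) / 10\<rfloor>"
    have m: "real m \<le> (l - 8) / 10" "(l - 8) / 10 < real m + 1" "m \<ge> 1"
    proof -
      have "1 \<le> \<lfloor>(l - 8) / 10\<rfloor>" using True by (simp add: le_floor_iff)
      then have "real m = of_int \<lfloor>(l - 8) / 10\<rfloor>" "m \<ge> 1" unfolding m_def by linarith+
      then show "real m \<le> (l - 8) / 10" "(l - 8) / 10 < real m + 1" "m \<ge> 1" by linarith+
    qed
    define T where "T = (1 / 1024 :: real) ^ m"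
    have gapT: "\<epsilon>\<^sub>2 - \<epsilon>\<^sub>1 \<le> T / 256"
    proof -
      have "\<epsilon>\<^sub>2 - \<epsilon>\<^sub>1 \<le> 2 powr (- real (10 * m + 8))" unfolding \<delta> using m by (intro powr_mono) auto
      also have "\<dots> = T / 256"
      proof -
        have "2 powr real (10 * m + 8) = (2::real) ^ (10 * m + 8)" by (rule powr_realpow) simp
        also have "\<dots> = (2 ^ 10) ^ m * 2 ^ 8" unfolding power_add power_mult ..
        also have "\<dots> = 1024 ^ m * 256" by simp
        finally have eq: "2 powr real (10 * m + 8) = 1024 ^ m * (256 :: real)" .
        have "2 powr (- real (10 * m + 8)) = inverse (2 powr real (10 * m + 8))" by (rule powr_minus)
        also have "\<dots> = inverse (1024 ^ m * 256)" by (rule arg_cong[OF eq])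
        also have "\<dots> = T / 256" unfolding T_def by (simp add: power_one_over field_simps)
        finally show ?thesis .
      qed
      finally show ?thesis .
    qed
    note params = small_gap_parameters[OF m(3) T_def \<epsilon>(1,3) gapT \<epsilon>(2) refl]
    have "real E ^ (m + 1) \<le> 10 * (real q)\<^sup>2"
    proof (rule tester_queries_lower_bound[OF tester q _ E3 _ _ _ \<gamma>0 k ka _ refl params(1) _ params(2,3)])
      show "real (10 * m + 7) + real (200 * m) * real E * real a + real (200 * m) * (real E)\<^sup>2 + \<gamma> * real k
          \<le> real k / (2 * real E)"
        unfolding y10[symmetric]
        by (rule size_bound) (use y E3 E4y \<gamma>E ay m ly in auto)
    qed (use m \<epsilon> in auto)
    moreover have "l \<le> 18 * real (m + 1)" using m by (simp add: field_simps)
    ultimately show ?thesis by (intro exI[of _ "m + 1"]) auto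
  next
    case False
    have \<epsilon>2: "0 < \<epsilon>\<^sub>2" using \<epsilon> by linarith
    note params = large_gap_parameters[OF \<epsilon>(1,3) \<epsilon>2 refl]
    have "real E ^ 1 \<le> 10 * (real q)\<^sup>2"
    proof (rule tester_queries_lower_bound[OF tester q _ E3 _ _ _ \<gamma>0 k ka _ refl params(1) \<epsilon>2 params(2,3)])
      show "real 7 + real 80 * real E * real a + real 80 * (real E)\<^sup>2 + \<gamma> * real k
          \<le> real k / (2 * real E)"
        unfolding y10[symmetric]
        by (rule size_bound) (use y E3 E4y \<gamma>E ay in auto)
    qed auto
    then show ?thesis using False by (intro exI[of _ 1]) auto
  qed
  then obtain s where s: "s \<ge> 1" "l \<le> 18 * real s" "real E ^ s \<le> 10 * (real q)\<^sup>2" by blast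
  \<comment> \<open>Half of \<open>B ^ (4 * s)\<close> in the exponent pays for the factor 10; the
    other half survives the square root as \<open>B ^ s\<close>.\<close>
  have "10 \<le> B ^ (2 * s)"
  proof -
    have "(10::real) \<le> 8 ^ 2" by simp
    also have "\<dots> \<le> 8 ^ (2 * s)" using s(1) by (intro power_increasing) auto
    also have "\<dots> \<le> B ^ (2 * s)" using B by (intro power_mono) auto
    finally show ?thesis .
  qed
  then have "10 * B ^ (2 * s) \<le> B ^ (2 * s) * B ^ (2 * s)" using B by (intro mult_right_mono) auto
  also have "\<dots> = (B ^ 4) ^ s" by (simp flip: power_add power_mult)
  also have "\<dots> \<le> real E ^ s" using Ege B by (intro power_mono) auto
  finally have "(B ^ s)\<^sup>2 \<le> (real q)\<^sup>2" using s(3) by (simp add: mult.commute flip: power_mult)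
  then have Bs: "B ^ s \<le> real q" by (rule power2_le_imp_le) simp
  have one: "1 \<le> 1 / \<gamma>" using \<gamma>inv by (smt (verit) one_le_power)
  \<comment> \<open>\<open>576 = 32 * 18\<close>: the root defining \<open>B\<close> times the loss
    between \<open>l\<close> and \<open>s\<close>.\<close>
  have "(1 / \<gamma>) powr (1 / 576 * l) \<le> (1 / \<gamma>) powr (1 / 32 * real s)"
    using s(2) one by (intro powr_mono) auto
  also have "\<dots> = B ^ s" using \<gamma>0 by (simp add: B_def powr_powr flip: powr_realpow)
  finally show ?thesis using Bs unfolding l_def by linarith
qed

theorem theorem2:
  "\<exists>\<gamma>\<^sub>0 > (0::real). \<exists>c > (0::real).
     \<forall>(\<epsilon>\<^sub>1::real) (\<epsilon>\<^sub>2::real) (\<gamma>::real) (k::nat) A.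
       k \<ge> 1 \<longrightarrow>
       0.01 \<le> \<epsilon>\<^sub>1 \<longrightarrow> \<epsilon>\<^sub>1 < \<epsilon>\<^sub>2 \<longrightarrow> \<epsilon>\<^sub>2 \<le> 0.49 \<longrightarrow>
       \<epsilon>\<^sub>2 - \<epsilon>\<^sub>1 \<ge> 2 powr (- (real k powr 0.1)) \<longrightarrow>
       1 / real k \<le> \<gamma> \<longrightarrow> \<gamma> \<le> \<gamma>\<^sub>0 \<longrightarrow>
       is_junta_tester (real k) ((1 + \<gamma>) * real k) \<epsilon>\<^sub>1 \<epsilon>\<^sub>2 A \<longrightarrow>
       ereal_of_enat (query_complexity A) \<ge>
         ereal ((1 / \<gamma>) powr (c * (- log 2 (\<epsilon>\<^sub>2 - \<epsilon>\<^sub>1))))"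
proof (rule exI[of _ "1 / 2 ^ 100"], rule conjI, simp, rule exI[of _ "1 / 576"], rule conjI, simp,
    intro allI impI)
  fix \<epsilon>\<^sub>1 \<epsilon>\<^sub>2 \<gamma> :: real and k :: nat and A
  assume k: "k \<ge> 1" and \<epsilon>: "0.01 \<le> \<epsilon>\<^sub>1" "\<epsilon>\<^sub>1 < \<epsilon>\<^sub>2" "\<epsilon>\<^sub>2 \<le> 0.49"
    and gap: "\<epsilon>\<^sub>2 - \<epsilon>\<^sub>1 \<ge> 2 powr (- (real k powr 0.1))"
    and \<gamma>: "1 / real k \<le> \<gamma>" "\<gamma> \<le> 1 / 2 ^ 100"
    and tester: "is_junta_tester (real k) ((1 + \<gamma>) * real k) \<epsilon>\<^sub>1 \<epsilon>\<^sub>2 A"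
  show "ereal_of_enat (query_complexity A) \<ge>
         ereal ((1 / \<gamma>) powr (1 / 576 * (- log 2 (\<epsilon>\<^sub>2 - \<epsilon>\<^sub>1))))"
  proof (cases "query_complexity A")
    case (enat q)
    have "(1 / \<gamma>) powr (1 / 576 * (- log 2 (\<epsilon>\<^sub>2 - \<epsilon>\<^sub>1))) \<le> real q"
    proof (rule power_lower_bound_from_tester[OF k _ \<epsilon>(2) _ _ \<gamma> tester])
      show "num_queries t f \<le> q" if "t \<in> set_pmf (A n)" for n t f
        using num_queries_le_query_complexity[where A = A and n = n and t = t and f = f, OF that] enat by simp
    qed (use \<epsilon> gap in simp_all)
    then show ?thesis using enat by simp
  qed simp
qed

end
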